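(* Let $\Omega=(a,b)\subset\mathbb{R}$ be a bounded open interval, let $\phi:\mathbb{R}\to\mathbb{R}$ be an odd increasing homeomorphism, let $f,g:[0,\infty)\to[0,\infty)$ be continuous functions, and let $0\le m,n\in L^1(\Omega)$. For $\lambda,\mu>0$ consider the problem $$(P_{\lambda,\mu})\qquad \begin{cases}-\phi(u')'=\lambda m(x)f(u)+\mu n(x)g(u) & \text{in }\Omega,\\ u=0 & \text{on }\partial\Omega.\end{cases}$$ Consider the following conditions. (F) There exist $c_0,t_0,q>0$ such that $f(t)\ge c_0t^q$ for all $t\in[0,t_0]$ and $\lim_{t\to0^+}\frac{t^q}{\phi(t)}=\infty$. (G1) There exist $c_1,t_1,r_1>0$ such that $g(t)\le c_1t^{r_1}$ for all $t\in[0,t_1]$ and $\lim_{t\to0^+}\frac{t^{r_1}}{\phi(t)}=0$. (G2) There exist $c_2,t_2,r_2>0$ such that $g(t)\ge c_2t^{r_2}$ for all $t\ge t_2$ and $\lim_{t\to\infty}\frac{t^{r_2}}{\phi(t)}=\infty$. Then: (I) Assume that $m\not\equiv0$ and that (F) and (G1) hold. Then for all $\mu>0$ there exists $\lambda_0(\mu)>0$ such that $(P_{\lambda,\mu})$ has a solution $u_\lambda\in\mathcal{P}^\circ$ for all $0<\lambda<\lambda_0(\mu)$. Moreover, the solutions $u_\lambda$ can be chosen such that $\lim_{\lambda\to0^+}\|u_\lambda\|_\infty=0$. (II) Assume that $n\not\equiv0$ and that (G1) and (G2) hold. Then for all $\mu>0$ there exists $\lambda_1(\mu)>0$ such that $(P_{\lambda,\mu})$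 has a solution $v_\lambda\in\mathcal{P}^\circ$ for all $0<\lambda<\lambda_1(\mu)$. Furthermore, there exists $\rho>0$ such that $\|v_\lambda\|_\infty>\rho$ for all $0<\lambda<\lambda_1(\mu)$. (III) Let $\mu>0$. Assume that $\{\lambda>0:(P_{\lambda,\mu})\text{ has a solution in }\mathcal{P}^\circ\}\neq\emptyset$ and that (F) holds for all $t_0>0$ (that is, for every $t_0>0$ there exist $c_0,q>0$ with the two properties required in (F)). Let $$\Lambda:=\sup\{\lambda>0:(P_{\lambda,\mu})\text{ has a solution in }\mathcal{P}^\circ\}\in(0,\infty].$$ Then for every $0<\lambda<\Lambda$ the problem $(P_{\lambda,\mu})$ has at least one solution in $\mathcal{P}^\circ$.
   Context: $\mathcal{C}_0^1(\overline\Omega):=\{u\in\mathcal{C}^1(\overline\Omega):u=0\text{ on }\partial\Omega\}$ and $$\mathcal{P}^\circ:=\{u\in\mathcal{C}_0^1(\overline\Omega):u>0\text{ in }\Omega\text{ and }u'(b)<0<u'(a)\}.$$ A solution of $(P_{\lambda,\mu})$ in $\mathcal{P}^\circ$ is a function $u\in\mathcal{P}^\circ$ such that $\phi(u')$ is absolutely continuous on $\overline\Omega$ and the equation holds for a.e. $x\in\Omega$. Inequalities such as $0\le m$ and $m\not\equiv0$ are understood in the a.e. sense. *)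

theory Defs
  imports "HOL-Analysis.Analysis"
begin

definition abs_continuous_on_interval :: "real \<Rightarrow> real \<Rightarrow> (real \<Rightarrow> real) \<Rightarrow> bool" where
  "abs_continuous_on_interval a b h \<longleftrightarrow>
     (\<forall>\<epsilon>>0. \<exists>\<delta>>0. \<forall>(N::nat) (s::nat \<Rightarrow> real) t.
        (\<forall>i<N. a \<le> s i \<and> s i \<le> t i \<and> t i \<le> b) \<and>
        disjoint_family_on (\<lambda>i. {s i<..<t i}) {..<N} \<and>
        (\<Sum>i<N. t i - s i) < \<delta>
        \<longrightarrow> (\<Sum>i<N. \<bar>h (t i) - h (s i)\<bar>) < \<epsilon>)"

text \<open>The derivative relative to the closed interval: one-sided at the end points, so that
  it does not depend on the values of \<open>u\<close> outside \<open>[a, b]\<close>.\<close>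

definition ideriv :: "real \<Rightarrow> real \<Rightarrow> (real \<Rightarrow> real) \<Rightarrow> real \<Rightarrow> real" where
  "ideriv a b u x = vector_derivative u (at x within {a..b})"

definition C1_zero :: "real \<Rightarrow> real \<Rightarrow> (real \<Rightarrow> real) set" where
  "C1_zero a b = {u. u differentiable_on {a..b} \<and> continuous_on {a..b} (ideriv a b u) \<and>
                     u a = 0 \<and> u b = 0}"

definition pos_cone_interior :: "real \<Rightarrow> real \<Rightarrow> (real \<Rightarrow> real) set" where
  "pos_cone_interior a b =
     {u \<in> C1_zero a b. (\<forall>x\<in>{a<..<b}. 0 < u x) \<and> ideriv a b u b < 0 \<and> 0 < ideriv a b u a}"

definition sup_norm_on :: "real \<Rightarrow> real \<Rightarrow> (real \<Rightarrow> real) \<Rightarrow> real" where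
  "sup_norm_on a b u = (SUP x\<in>{a..b}. \<bar>u x\<bar>)"

text \<open>Solutions, in \<open>pos_cone_interior a b\<close>, of
  \<open>- (\<phi>(u'))' = lam m f(u) + mu n g(u)\<close> with zero Dirichlet boundary values.\<close>

definition solution ::
  "real \<Rightarrow> real \<Rightarrow> (real \<Rightarrow> real) \<Rightarrow> (real \<Rightarrow> real) \<Rightarrow> (real \<Rightarrow> real) \<Rightarrow>
   (real \<Rightarrow> real) \<Rightarrow> (real \<Rightarrow> real) \<Rightarrow> real \<Rightarrow> real \<Rightarrow> (real \<Rightarrow> real) \<Rightarrow> bool" where
  "solution a b \<phi> f g m n lam mu u \<longleftrightarrow>
     u \<in> pos_cone_interior a b \<and>
     abs_continuous_on_interval a b (\<lambda>x. \<phi> (ideriv a b u x)) \<and>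
     (AE x in lebesgue_on {a<..<b}.
        ((\<lambda>y. \<phi> (ideriv a b u y)) has_real_derivative
           - (lam * m x * f (u x) + mu * n x * g (u x))) (at x))"

definition cond_F_at :: "(real \<Rightarrow> real) \<Rightarrow> (real \<Rightarrow> real) \<Rightarrow> real \<Rightarrow> bool" where
  "cond_F_at \<phi> f t0 \<longleftrightarrow>
     (\<exists>c0>0. \<exists>q>0. (\<forall>t\<in>{0..t0}. f t \<ge> c0 * t powr q) \<and>
        filterlim (\<lambda>t. t powr q / \<phi> t) at_top (at_right 0))"

definition cond_F :: "(real \<Rightarrow> real) \<Rightarrow> (real \<Rightarrow> real) \<Rightarrow> bool" where
  "cond_F \<phi> f \<longleftrightarrow> (\<exists>t0>0. cond_F_at \<phi> f t0)"

definition cond_G1 :: "(real \<Rightarrow> real) \<Rightarrow> (real \<Rightarrow> real) \<Rightarrow> bool" where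
  "cond_G1 \<phi> g \<longleftrightarrow>
     (\<exists>c1>0. \<exists>t1>0. \<exists>r1>0. (\<forall>t\<in>{0..t1}. g t \<le> c1 * t powr r1) \<and>
        ((\<lambda>t. t powr r1 / \<phi> t) \<longlongrightarrow> 0) (at_right 0))"

definition cond_G2 :: "(real \<Rightarrow> real) \<Rightarrow> (real \<Rightarrow> real) \<Rightarrow> bool" where
  "cond_G2 \<phi> g \<longleftrightarrow>
     (\<exists>c2>0. \<exists>t2>0. \<exists>r2>0. (\<forall>t\<ge>t2. g t \<ge> c2 * t powr r2) \<and>
        filterlim (\<lambda>t. t powr r2 / \<phi> t) at_top at_top)"

end

theory Submission
  imports Defs "HOL-Complex_Analysis.Great_Picard"
begin

text \<open>
  Let \<open>\<psi>\<close> be the inverse of \<open>\<phi>\<close>. Two integrations turn the equation into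
  \<open>u x = \<integral>\<^sub>a\<^sup>x \<psi> (s - \<integral>\<^sub>a\<^sup>t h) dt\<close> with \<open>u b = 0\<close>, where \<open>h\<close> is the right-hand side along \<open>u\<close> and
  \<open>s = \<phi> (u' a)\<close>. The Lebesgue differentiation theorem, the absolute continuity of indefinite
  integrals and the fundamental theorem of calculus for absolutely continuous functions
  translate between the two forms (\<open>solution_of_profile\<close>, \<open>profile_of_solution\<close>). As \<open>h \<ge> 0\<close>, the
  slope \<open>u'\<close> is nonincreasing: \<open>u\<close> is concave, and nearly every estimate below is a consequence of
  that. In particular \<open>u\<close> is at most \<open>(b - a) * \<psi> s\<close>, and it is bounded below by a multiple of the
  distance to the boundary, with a factor that grows with the mass of \<open>h\<close> on an inner interval
  (\<open>profile_lower_bound\<close>).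

  Solutions are found by shooting, with the intermediate value theorem applied to \<open>u b\<close> as a
  function of \<open>s\<close>. The initial value problem need not have a unique solution, because \<open>f\<close> and \<open>g\<close> are
  only continuous and \<open>\<psi>\<close> need not be Lipschitz, so \<open>u b\<close> is not a function of \<open>s\<close>. With a delay
  \<open>\<delta> > 0\<close> in the reaction term it is: the delayed problem is solved by finitely many explicit
  integrations, each continuous in \<open>s\<close>. By the theorem of Arzela and Ascoli, solutions of delayed
  problems accumulate at solutions of the original one as \<open>\<delta> \<rightarrow> 0\<close>, so the sign of \<open>u b\<close> has to be
  known for the original problem only (\<open>shooting\<close>).

  For small solutions the argument of \<open>f\<close> and \<open>g\<close> is clipped between \<open>\<epsilon>\<close> times the distance to
  the boundary and an upper barrier, which makes the source bounded and shooting immediate. The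
  lower barrier maintains itself: the clipped argument is at least of order \<open>\<epsilon>\<close> on an inner
  interval, so by (F) the source has mass of order \<open>\<epsilon> powr q\<close> there, and concavity gives a height of
  order \<open>\<psi> (C * \<epsilon> powr q)\<close>, which beats \<open>\<epsilon>\<close> for small \<open>\<epsilon>\<close> precisely because \<open>t powr q / \<phi> t\<close> tends to
  infinity (\<open>clipped_solution_above_barrier\<close>). The upper barrier is a small constant in the first
  part, where (G1) keeps the total mass of the source below what is needed to reach it. In the
  third part it is a solution for a larger \<open>\<lambda>\<close>, which is a supersolution for the smaller one.

  For large solutions, (G1) makes \<open>u b\<close> positive for a small initial flux \<open>s\<close> and small \<open>\<lambda>\<close>: the
  source is too weak to bend \<open>u\<close> back to zero. If \<open>s\<close> is very large, then \<open>u\<close> is large, and by (G2)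
  the source on an inner interval changes the flux by more than a concave function of that height
  with \<open>u b \<ge> 0\<close> permits, so \<open>u b < 0\<close>. The solution found in between exceeds a height that does
  not depend on \<open>\<lambda>\<close>, since otherwise the first argument would give \<open>u b > 0\<close>.
\<close>

section \<open>Lebesgue differentiation and absolute continuity\<close>

text \<open>
  Lebesgue's differentiation theorem on the line. If the difference quotient at \<open>x\<close> misses \<open>h x\<close> by
  more than \<open>c\<close> over arbitrarily short intervals with end point \<open>x\<close>, call these intervals bad. They
  form a Vitali cover of the set of such \<open>x\<close>, and finitely many disjoint bad intervals that are fine
  for a suitable gauge have small total length by Henstock's lemma. So that set is negligible.
\<close>

lemma ae_has_derivative_indefinite_integral:
  fixes h :: "real \<Rightarrow> real"
  assumes h: "h integrable_on {a..b}"
  shows "\<exists>E. negligible E \<and> (\<forall>x\<in>{a<..<b} - E.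
           ((\<lambda>y. integral {a..y} h) has_real_derivative h x) (at x))"
proof -
  define H where "H y = integral {a..y} h" for y
  define I where "I = (\<lambda>p::real \<times> real. {min (fst p) (snd p)..max (fst p) (snd p)})"
  define bad where "bad c p \<longleftrightarrow> fst p \<noteq> snd p \<and> I p \<subseteq> {a..b} \<and>
      c * measure lborel (I p) < \<bar>measure lborel (I p) * h (fst p) - integral (I p) h\<bar>" for c and p :: "real \<times> real"
  define E where "E c = {x\<in>{a<..<b}. \<forall>d>0. \<exists>y. \<bar>y - x\<bar> < d \<and> bad c (x, y)}" for c
  have neg: "negligible (E c)" if c: "c > 0" for c
    unfolding negligible_outer_le
  proof (intro allI impI)
    fix e :: real assume e: "e > 0"
    have "h integrable_on cbox a b" using h by simp
    then obtain \<gamma> where \<gamma>: "gauge \<gamma>" and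
      hen: "\<And>p. \<lbrakk>p tagged_partial_division_of (cbox a b); \<gamma> fine p\<rbrakk> \<Longrightarrow>
             sum (\<lambda>(x,k). norm (measure lborel k *\<^sub>R h x - integral k h)) p < c * e"
      using Henstock_lemma[of h a b "c * e"] c e by auto
    \<comment> \<open>a bad interval is coded by the pair of its tag and its other end point, and seen by the
      covering theorem as a ball\<close>
    define K where "K = {p. bad c p \<and> I p \<subseteq> \<gamma> (fst p)}"
    define mid where "mid p = (fst p + snd p) / 2" for p :: "real \<times> real"
    define rad where "rad p = \<bar>snd p - fst p\<bar> / 2" for p :: "real \<times> real"
    have cb: "cball (mid p) (rad p) = I p" for p
      unfolding mid_def rad_def cball_eq_atLeastAtMost I_def by (auto simp: min_def max_def abs_if field_simps)
    obtain C where C: "countable C" "C \<subseteq> K"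
      and dj: "pairwise (\<lambda>i j. disjnt (cball (mid i) (rad i)) (cball (mid j) (rad j))) C"
      and cov: "negligible (E c - (\<Union>i\<in>C. cball (mid i) (rad i)))"
    proof (rule Vitali_covering_theorem_cballs [of K rad "E c" mid])
      show "0 < rad i" if "i \<in> K" for i
        using that unfolding K_def bad_def rad_def by auto
      show "\<exists>i. i \<in> K \<and> x \<in> cball (mid i) (rad i) \<and> rad i < d" if x: "x \<in> E c" and d: "0 < d" for x d
      proof -
        obtain d' where d': "d' > 0" "ball x d' \<subseteq> \<gamma> x"
          using \<gamma> openE[of "\<gamma> x" x] unfolding gauge_def by blast
        have "\<forall>d>0. \<exists>y. \<bar>y - x\<bar> < d \<and> bad c (x, y)" using x by (simp add: E_def)
        moreover have "min d d' > 0" using d d' by simp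
        ultimately obtain y where y: "\<bar>y - x\<bar> < min d d'" "bad c (x, y)" by blast
        have "I (x, y) \<subseteq> ball x d'"
          using y by (auto simp: I_def dist_real_def min_def max_def abs_if split: if_splits)
        moreover have "x \<in> I (x, y)" by (simp add: I_def)
        ultimately have "(x, y) \<in> K" "x \<in> cball (mid (x, y)) (rad (x, y))"
          using y d' by (auto simp only: cb K_def fst_conv mem_Collect_eq)
        moreover have "rad (x, y) < d" using y d by (simp add: rad_def)
        ultimately show ?thesis by blast
      qed
    qed
    have fin: "measure lebesgue (\<Union>i\<in>D. I i) \<le> e" if D: "D \<subseteq> C" "finite D" for D
    proof -
      have inj: "inj_on (\<lambda>i. (fst i, I i)) D"
      proof (rule inj_onI)
        fix i j assume ij: "i \<in> D" "j \<in> D" "(fst i, I i) = (fst j, I j)"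
        have "i = j \<or> disjnt (I i) (I j)" using dj ij D unfolding pairwise_def cb by blast
        moreover have "fst i \<in> I i" by (auto simp: I_def)
        ultimately show "i = j" using ij by (auto simp: disjnt_iff)
      qed
      have tag: "(\<lambda>i. (fst i, I i)) ` D tagged_partial_division_of cbox a b"
        unfolding tagged_partial_division_of_def
      proof (intro conjI allI impI)
        fix x1 K1 x2 K2
        assume "(x1, K1) \<in> (\<lambda>i. (fst i, I i)) ` D \<and> (x2, K2) \<in> (\<lambda>i. (fst i, I i)) ` D \<and> (x1, K1) \<noteq> (x2, K2)"
        then obtain i j where ij: "i \<in> D" "j \<in> D" "K1 = I i" "K2 = I j" "i \<noteq> j" by auto
        then have "disjnt (I i) (I j)" using dj D unfolding pairwise_def cb by blast
        then have "K1 \<inter> K2 = {}" by (simp add: ij disjnt_def)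
        then show "interior K1 \<inter> interior K2 = {}"
          using interior_subset by blast
      next
        show "finite ((\<lambda>i. (fst i, I i)) ` D)" using D by simp
        fix x K1 assume "(x, K1) \<in> (\<lambda>i. (fst i, I i)) ` D"
        then obtain i where i: "i \<in> D" "x = fst i" "K1 = I i" by auto
        show "x \<in> K1" by (simp add: i I_def)
        show "K1 \<subseteq> cbox a b" using i D C by (auto simp: K_def bad_def)
        show "\<exists>a b. K1 = cbox a b" by (auto simp: i I_def)
      qed
      have fine: "\<gamma> fine (\<lambda>i. (fst i, I i)) ` D"
        using D C by (auto simp: fine_def K_def)
      have "c * measure lebesgue (\<Union>i\<in>D. I i) \<le> c * (\<Sum>i\<in>D. measure lebesgue (I i))"
        using c D by (intro mult_left_mono measure_UNION_le) (auto simp: I_def)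
      also have "\<dots> = (\<Sum>i\<in>D. c * measure lborel (I i))"
        by (simp add: sum_distrib_left I_def)
      also have "\<dots> \<le> (\<Sum>i\<in>D. \<bar>measure lborel (I i) * h (fst i) - integral (I i) h\<bar>)"
        using D C by (intro sum_mono) (auto simp: K_def bad_def less_imp_le)
      also have "\<dots> = sum (\<lambda>(x,k). norm (measure lborel k *\<^sub>R h x - integral k h)) ((\<lambda>i. (fst i, I i)) ` D)"
        by (simp add: sum.reindex[OF inj])
      also have "\<dots> < c * e" by (rule hen[OF tag fine])
      finally show ?thesis using c by simp
    qed
    have Im: "I i \<in> lmeasurable" for i by (simp add: I_def)
    have U: "(\<Union>i\<in>C. I i) \<in> lmeasurable" "measure lebesgue (\<Union>i\<in>C. I i) \<le> e"
      using fmeasurable_UN_bound[OF C(1) Im fin] measure_UN_bound[OF C(1) Im fin] by simp_all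
    have N: "E c - (\<Union>i\<in>C. I i) \<in> lmeasurable" "measure lebesgue (E c - (\<Union>i\<in>C. I i)) = 0"
      using cov unfolding cb by (simp_all add: negligible_imp_measurable negligible_imp_measure0)
    show "\<exists>T. E c \<subseteq> T \<and> T \<in> lmeasurable \<and> measure lebesgue T \<le> e"
    proof (intro exI conjI)
      show "E c \<subseteq> (\<Union>i\<in>C. I i) \<union> (E c - (\<Union>i\<in>C. I i))" by blast
      show "(\<Union>i\<in>C. I i) \<union> (E c - (\<Union>i\<in>C. I i)) \<in> lmeasurable" using U N by blast
      have "measure lebesgue ((\<Union>i\<in>C. I i) \<union> (E c - (\<Union>i\<in>C. I i)))
          \<le> measure lebesgue (\<Union>i\<in>C. I i) + measure lebesgue (E c - (\<Union>i\<in>C. I i))"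
        by (rule measure_Un_le) (use U N in auto)
      then show "measure lebesgue ((\<Union>i\<in>C. I i) \<union> (E c - (\<Union>i\<in>C. I i))) \<le> e"
        using U N by simp
    qed
  qed
  define Z where "Z = (\<Union>k::nat. E (1 / Suc k))"
  have "negligible Z" unfolding Z_def by (intro negligible_countable_Union) (auto intro!: neg)
  moreover have "(H has_real_derivative h x) (at x)" if x: "x \<in> {a<..<b} - Z" for x
    unfolding has_field_derivative_iff LIM_eq
  proof (intro allI impI)
    fix r :: real assume "r > 0"
    then obtain k where k: "1 / real (Suc k) < r" by (metis nat_approx_posE)
    have "x \<notin> E (1 / Suc k)" using x by (auto simp: Z_def)
    then obtain d where d: "d > 0" "\<And>y. \<bar>y - x\<bar> < d \<Longrightarrow> \<not> bad (1 / Suc k) (x, y)"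
      using x unfolding E_def by auto
    define d' where "d' = min d (min (x - a) (b - x))"
    have d'0: "d' > 0" using d x by (auto simp: d'_def)
    show "\<exists>s>0. \<forall>y. y \<noteq> x \<and> norm (y - x) < s \<longrightarrow> norm ((H y - H x) / (y - x) - h x) < r"
    proof (intro exI[of _ d'] conjI d'0 allI impI)
      fix y assume y: "y \<noteq> x \<and> norm (y - x) < d'"
      then have yd: "\<bar>y - x\<bar> < d" "\<bar>y - x\<bar> < x - a" "\<bar>y - x\<bar> < b - x" unfolding d'_def by auto
      have sub: "I (x, y) \<subseteq> {a..b}" using yd by (auto simp: I_def)
      have con: "measure lborel (I (x, y)) = \<bar>y - x\<bar>" by (auto simp: I_def min_def max_def)
      have "\<not> bad (1 / Suc k) (x, y)" using d yd by blast
      then have le: "\<bar>\<bar>y - x\<bar> * h x - integral (I (x, y)) h\<bar> \<le> 1 / Suc k * \<bar>y - x\<bar>"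
        using y sub by (auto simp: bad_def con)
      have comb: "H v - H u = integral {u..v} h" if "a \<le> u" "u \<le> v" "v \<le> b" for u v
        using Henstock_Kurzweil_Integration.integral_combine[of a u v h] that h integrable_on_subinterval[OF h, of a v]
        by (auto simp: H_def)
      have HI: "integral (I (x, y)) h = sgn (y - x) * (H y - H x)"
        using comb[of x y] comb[of y x] x yd y by (auto simp: I_def min_def max_def sgn_if)
      have "\<bar>(H y - H x) / (y - x) - h x\<bar> * \<bar>y - x\<bar> = \<bar>(H y - H x) - h x * (y - x)\<bar>"
        using y by (simp add: abs_mult[symmetric] field_simps)
      also have "\<dots> = \<bar>\<bar>y - x\<bar> * h x - integral (I (x, y)) h\<bar>"
        unfolding HI using y by (cases "y > x") (auto simp: sgn_if algebra_simps abs_minus_commute)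
      also note le
      finally have "\<bar>(H y - H x) / (y - x) - h x\<bar> \<le> 1 / Suc k"
        using y by (metis mult_le_cancel_right_pos right_minus_eq zero_less_abs_iff)
      then show "norm ((H y - H x) / (y - x) - h x) < r" using k by simp
    qed
  qed
  ultimately show ?thesis unfolding H_def by blast
qed

text \<open>
  The integrand splits into \<open>min h k\<close>, whose indefinite integral is Lipschitz with constant \<open>k\<close>, and a
  nonnegative remainder whose integral over the whole interval is small for large \<open>k\<close>.
\<close>

lemma abs_continuous_indefinite_integral:
  fixes h :: "real \<Rightarrow> real"
  assumes h: "h integrable_on {a..b}" and nonneg: "\<And>x. x \<in> {a..b} \<Longrightarrow> 0 \<le> h x"
  shows "abs_continuous_on_interval a b (\<lambda>y. integral {a..y} h)"
  unfolding abs_continuous_on_interval_def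
proof (intro allI impI)
  fix \<epsilon> :: real assume \<epsilon>: "\<epsilon> > 0"
  have absint: "h absolutely_integrable_on {a..b}"
    using nonnegative_absolutely_integrable_1[OF h nonneg] .
  have cut_int: "(\<lambda>x. min (h x) (real k)) integrable_on {a..b}" for k :: nat
    using absolutely_integrable_min_1[OF absint, of "\<lambda>_. real k"]
    by (auto intro: set_lebesgue_integral_eq_integral)
  have "(\<lambda>k. integral {a..b} (\<lambda>x. min (h x) (real k))) \<longlonglongrightarrow> integral {a..b} h"
  proof (rule dominated_convergence(2)[where h = h])
    show "(\<lambda>k. min (h x) (real k)) \<longlonglongrightarrow> h x" for x
    proof (rule tendsto_eventually)
      obtain N where "h x \<le> real N" using real_arch_simple by blast
      then show "\<forall>\<^sub>F k in sequentially. min (h x) (real k) = h x"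
        by (intro eventually_sequentiallyI[of N]) (auto simp: min_def)
    qed
  qed (use h cut_int nonneg in auto)
  then obtain k where k: "\<bar>integral {a..b} (\<lambda>x. min (h x) (real k)) - integral {a..b} h\<bar> < \<epsilon> / 2"
    using \<epsilon> LIMSEQ_D[of _ "integral {a..b} h" "\<epsilon> / 2"] by fastforce
  define r where "r x = h x - min (h x) (real k)" for x
  have r_int: "r integrable_on {a..b}" unfolding r_def using h cut_int by (rule Henstock_Kurzweil_Integration.integrable_diff)
  have r_small: "integral {a..b} r < \<epsilon> / 2"
    using k unfolding r_def by (subst integral_diff[OF h cut_int]) linarith
  define \<delta> where "\<delta> = \<epsilon> / (2 * (real k + 1))"
  show "\<exists>\<delta>>0. \<forall>(N::nat) (s::nat \<Rightarrow> real) t.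
        (\<forall>i<N. a \<le> s i \<and> s i \<le> t i \<and> t i \<le> b) \<and>
        disjoint_family_on (\<lambda>i. {s i<..<t i}) {..<N} \<and> (\<Sum>i<N. t i - s i) < \<delta>
        \<longrightarrow> (\<Sum>i<N. \<bar>integral {a..t i} h - integral {a..s i} h\<bar>) < \<epsilon>"
  proof (intro exI[of _ \<delta>] conjI allI impI)
    show "\<delta> > 0" using \<epsilon> by (simp add: \<delta>_def)
    fix N :: nat and s t :: "nat \<Rightarrow> real"
    assume asm: "(\<forall>i<N. a \<le> s i \<and> s i \<le> t i \<and> t i \<le> b) \<and>
        disjoint_family_on (\<lambda>i. {s i<..<t i}) {..<N} \<and> (\<Sum>i<N. t i - s i) < \<delta>"
    have sub: "g integrable_on {s i..t i}" if "g integrable_on {a..b}" "i < N" for g :: "real \<Rightarrow> real" and i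
      using integrable_on_subinterval[OF that(1), of "s i" "t i"] asm that by auto
    have one: "\<bar>integral {a..t i} h - integral {a..s i} h\<bar> \<le> real k * (t i - s i) + integral {s i..t i} r"
      if i: "i < N" for i
    proof -
      have le: "a \<le> s i" "s i \<le> t i" "t i \<le> b" using asm i by auto
      have "integral {a..s i} h + integral {s i..t i} h = integral {a..t i} h"
        using le by (intro Henstock_Kurzweil_Integration.integral_combine integrable_on_subinterval[OF h]) auto
      moreover have "integral {s i..t i} h \<ge> 0"
        using le nonneg by (intro integral_nonneg sub[OF h i]) auto
      moreover have "integral {s i..t i} h = integral {s i..t i} (\<lambda>x. min (h x) (real k)) + integral {s i..t i} r"
        using integral_add[OF sub[OF cut_int[of k] i] sub[OF r_int i]] by (simp add: r_def)
      moreover have "integral {s i..t i} (\<lambda>x. min (h x) (real k)) \<le> integral {s i..t i} (\<lambda>x. real k)"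
        by (intro integral_le sub[OF cut_int i]) auto
      ultimately show ?thesis using le by (simp add: algebra_simps)
    qed
    have r0: "r x \<ge> 0" for x by (simp add: r_def)
    define q where "q i x = (if x \<in> {s i<..<t i} then r x else 0)" for i x
    have q_int: "(q i has_integral integral {s i..t i} r) {a..b}" if i: "i < N" for i
    proof -
      have "(r has_integral integral {s i..t i} r) {s i<..<t i}"
        using integrable_integral[OF sub[OF r_int i]] by (simp add: has_integral_Icc_iff_Ioo)
      moreover have "{s i<..<t i} \<subseteq> {a..b}" using asm i by auto
      ultimately show ?thesis unfolding q_def by (simp only: has_integral_restrict)
    qed
    have "((\<lambda>x. \<Sum>i<N. q i x) has_integral (\<Sum>i<N. integral {s i..t i} r)) {a..b}"
      by (intro has_integral_sum) (use q_int in auto)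
    moreover have "(\<Sum>i<N. q i x) \<le> r x" for x
    proof (cases "\<exists>j<N. x \<in> {s j<..<t j}")
      case True
      then obtain j where j: "j < N" "x \<in> {s j<..<t j}" by blast
      have "(\<Sum>i<N. q i x) = (\<Sum>i<N. if i = j then r x else 0)"
      proof (rule sum.cong)
        fix i assume "i \<in> {..<N}"
        then show "q i x = (if i = j then r x else 0)"
          using j asm unfolding disjoint_family_on_def q_def by fastforce
      qed simp
      then show ?thesis using j by simp
    next
      case False
      then have "(\<Sum>i<N. q i x) = 0" by (intro sum.neutral) (auto simp: q_def)
      then show ?thesis using r0 by simp
    qed
    ultimately have tail: "(\<Sum>i<N. integral {s i..t i} r) \<le> integral {a..b} r"
      by (rule has_integral_le[OF _ integrable_integral[OF r_int]])
    have "(\<Sum>i<N. \<bar>integral {a..t i} h - integral {a..s i} h\<bar>)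
        \<le> (\<Sum>i<N. real k * (t i - s i) + integral {s i..t i} r)"
      by (intro sum_mono one) auto
    also have "\<dots> = real k * (\<Sum>i<N. t i - s i) + (\<Sum>i<N. integral {s i..t i} r)"
      by (simp add: sum.distrib sum_distrib_left)
    also have "\<dots> \<le> real k * \<delta> + integral {a..b} r"
      using asm tail by (intro add_mono mult_left_mono) auto
    also have "real k * \<delta> \<le> \<epsilon> / 2" using \<epsilon> by (simp add: \<delta>_def field_simps)
    finally show "(\<Sum>i<N. \<bar>integral {a..t i} h - integral {a..s i} h\<bar>) < \<epsilon>" using r_small by simp
  qed
qed

text \<open>
  Absolute continuity is defined with families indexed by an initial segment of the naturals, while
  tagged divisions provide families indexed by their own elements.
\<close>

lemma abs_continuous_finite_family:
  assumes "abs_continuous_on_interval a b G" and "\<epsilon> > 0"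
  shows "\<exists>\<delta>>0. \<forall>(P :: 'i set) s t. finite P \<longrightarrow> (\<forall>i\<in>P. a \<le> s i \<and> s i \<le> t i \<and> t i \<le> b) \<longrightarrow>
      disjoint_family_on (\<lambda>i. {s i<..<t i}) P \<longrightarrow> (\<Sum>i\<in>P. t i - s i) < \<delta> \<longrightarrow>
      (\<Sum>i\<in>P. \<bar>G (t i) - G (s i)\<bar>) < \<epsilon>"
proof -
  obtain \<delta> where \<delta>: "\<delta> > 0" and *: "\<And>(N::nat) s t.
        (\<forall>i<N. a \<le> s i \<and> s i \<le> t i \<and> t i \<le> b) \<and>
        disjoint_family_on (\<lambda>i. {s i<..<t i}) {..<N} \<and>
        (\<Sum>i<N. t i - s i) < \<delta> \<Longrightarrow> (\<Sum>i<N. \<bar>G (t i) - G (s i)\<bar>) < \<epsilon>"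
    using assms unfolding abs_continuous_on_interval_def by meson
  have claim: "(\<Sum>i\<in>P. \<bar>G (t i) - G (s i)\<bar>) < \<epsilon>"
    if P: "finite P" "\<forall>i\<in>P. a \<le> s i \<and> s i \<le> t i \<and> t i \<le> b"
        "disjoint_family_on (\<lambda>i. {s i<..<t i}) P" "(\<Sum>i\<in>P. t i - s i) < \<delta>" for P :: "'i set" and s t
  proof -
    obtain e where e: "bij_betw e {..<card P} P"
      using P(1) ex_bij_betw_nat_finite[of P] by (auto simp: atLeast0LessThan)
    have eP: "e i \<in> P" if "i < card P" for i using e that bij_betwE by blast
    have "disjoint_family_on (\<lambda>i. {s (e i)<..<t (e i)}) {..<card P}"
      using P(3) eP bij_betw_imp_inj_on[OF e] unfolding disjoint_family_on_def inj_on_def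
      by (metis lessThan_iff)
    then have "(\<Sum>i<card P. \<bar>G (t (e i)) - G (s (e i))\<bar>) < \<epsilon>"
      using P(2,4) eP sum.reindex_bij_betw[OF e, of "\<lambda>i. t i - s i"]
      by (intro *[of "card P" "\<lambda>i. s (e i)" "\<lambda>i. t (e i)"]) auto
    then show ?thesis using sum.reindex_bij_betw[OF e, of "\<lambda>i. \<bar>G (t i) - G (s i)\<bar>"] by simp
  qed
  show ?thesis by (intro exI[of _ \<delta>] conjI allI impI \<delta> claim)
qed

text \<open>
  The fundamental theorem of calculus for absolutely continuous functions, straight from the gauge
  definition of the integral. At a tag outside the exceptional set the gauge is chosen by
  differentiability. At a tag inside it the gauge is an open superset of small measure, and absolute
  continuity bounds the total increment of \<open>G\<close> over the corresponding intervals.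
\<close>

lemma has_integral_derivative_of_abs_continuous:
  fixes G g :: "real \<Rightarrow> real"
  assumes ab: "a \<le> b" and ac: "abs_continuous_on_interval a b G" and E: "negligible E"
    and deriv: "\<And>x. x \<in> {a..b} - E \<Longrightarrow> (G has_real_derivative g x) (at x within {a..b})"
  shows "(g has_integral (G b - G a)) {a..b}"
proof -
  \<comment> \<open>with the integrand set to 0 on \<open>E\<close>, exceptional tags contribute only increments of \<open>G\<close>\<close>
  define g0 where "g0 x = (if x \<in> E then 0 else g x)" for x
  have "(g0 has_integral (G b - G a)) (cbox a b)"
    unfolding has_integral
  proof (intro allI impI)
    fix e :: real assume e: "e > 0"
    define c where "c = e / (2 * (b - a + 1))"
    have c: "c > 0" using e ab by (simp add: c_def)
    obtain \<delta> where \<delta>: "\<delta> > 0" and ac': "\<And>P s t. \<lbrakk>finite P; \<forall>i\<in>P. a \<le> s i \<and> s i \<le> t i \<and> t i \<le> b;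
        disjoint_family_on (\<lambda>i::real \<times> real set. {s i<..<t i}) P; (\<Sum>i\<in>P. t i - s i) < \<delta>\<rbrakk>
      \<Longrightarrow> (\<Sum>i\<in>P. \<bar>G (t i) - G (s i)\<bar>) < e / 2"
      using abs_continuous_finite_family[OF ac half_gt_zero[OF e], where ?'i = "real \<times> real set"] by blast
    have Es: "E \<in> sets lebesgue" using E by (simp add: negligible_imp_sets)
    obtain U where U: "open U" "E \<subseteq> U" "U - E \<in> lmeasurable" "emeasure lebesgue (U - E) < ennreal \<delta>"
      using sets_lebesgue_outer_open[OF Es \<delta>] by blast
    have Um: "U \<in> lmeasurable" using U E
      by (metis Un_Diff_cancel Un_absorb1 fmeasurable.Un negligible_imp_measurable)
    have Umes: "measure lebesgue U < \<delta>"
    proof -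
      have "measure lebesgue U \<le> measure lebesgue (U - E) + measure lebesgue E"
        using measure_Un_le[of "U - E" lebesgue E] U Es by (simp add: Un_absorb2)
      also have "measure lebesgue E = 0" using E by (simp add: negligible_imp_measure0)
      also have "measure lebesgue (U - E) < \<delta>"
        using U \<delta> by (metis emeasure_eq_measure2 ennreal_less_iff measure_nonneg)
      finally show ?thesis by simp
    qed
    have "\<exists>d>0. \<forall>y\<in>{a..b}. \<bar>y - x\<bar> < d \<longrightarrow> \<bar>G y - G x - (y - x) * g0 x\<bar> \<le> c * \<bar>y - x\<bar>"
      if x: "x \<in> {a..b} - E" for x
    proof -
      have "(G has_vector_derivative g0 x) (at x within {a..b})"
        using deriv[OF x] x by (simp add: g0_def has_real_derivative_iff_has_vector_derivative)
      then show ?thesis using c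
        unfolding has_vector_derivative_def has_derivative_within_alt by auto
    qed
    then obtain d where d: "\<And>x. x \<in> {a..b} - E \<Longrightarrow> d x > 0"
      "\<And>x y. \<lbrakk>x \<in> {a..b} - E; y \<in> {a..b}; \<bar>y - x\<bar> < d x\<rbrakk>
        \<Longrightarrow> \<bar>G y - G x - (y - x) * g0 x\<bar> \<le> c * \<bar>y - x\<bar>"
      by metis
    define \<gamma> where "\<gamma> x = (if x \<in> E then U else if x \<in> {a..b} then ball x (d x) else UNIV)" for x
    have "gauge \<gamma>" using U d by (auto simp: gauge_def \<gamma>_def)
    moreover have "norm ((\<Sum>(x,K)\<in>p. measure lborel K *\<^sub>R g0 x) - (G b - G a)) < e"
      if p: "p tagged_division_of (cbox a b)" "\<gamma> fine p" for p
    proof -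
      have p': "p tagged_division_of {a..b}" using p by simp
      have fin: "finite p" using p by blast
      define D where "D = (\<lambda>(x::real,K). G (Sup K) - G (Inf K))"
      define M where "M = (\<lambda>(x::real,K::real set). measure lborel K * g0 x)"
      have K: "\<exists>u v. K = {u..v} \<and> u \<le> x \<and> x \<le> v \<and> a \<le> u \<and> v \<le> b \<and> Inf K = u \<and> Sup K = v
                \<and> K \<subseteq> \<gamma> x" if xK: "(x, K) \<in> p" for x K
      proof -
        obtain u v where uv: "K = {u..v}" using tagged_division_ofD(4)[OF p' xK] by auto
        moreover have "x \<in> K" "K \<subseteq> {a..b}" using tagged_division_ofD(2,3)[OF p' xK] by auto
        moreover have "K \<subseteq> \<gamma> x" using p(2) xK by (auto simp: fine_def)
        ultimately show ?thesis by (intro exI[of _ u] exI[of _ v]) auto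
      qed
      have total: "(\<Sum>i\<in>p. D i) = G b - G a"
        using additive_tagged_division_1[OF ab p', of G] by (simp add: D_def)
      have len: "(\<Sum>i\<in>p. Sup (snd i) - Inf (snd i)) = b - a"
        using additive_tagged_division_1[OF ab p', of "\<lambda>x. x"] by (simp add: case_prod_unfold)
      define P where "P = {i\<in>p. fst i \<in> E}"
      have good: "\<bar>M i - D i\<bar> \<le> c * (Sup (snd i) - Inf (snd i))" if i: "i \<in> p - P" for i
      proof -
        obtain x K where xK: "i = (x, K)" by (cases i) auto
        then have "(x, K) \<in> p" "x \<notin> E" using i by (auto simp: P_def)
        then obtain u v where uv: "K = {u..v}" "u \<le> x" "x \<le> v" "a \<le> u" "v \<le> b" "Inf K = u" "Sup K = v"
            "K \<subseteq> \<gamma> x" using K by blast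
        have xab: "x \<in> {a..b} - E" using uv \<open>x \<notin> E\<close> by auto
        then have "\<gamma> x = ball x (d x)" by (simp add: \<gamma>_def)
        moreover have "u \<in> K" "v \<in> K" using uv(1-3) by auto
        ultimately have "u \<in> ball x (d x)" "v \<in> ball x (d x)" using uv(8) by auto
        then have "\<bar>G u - G x - (u - x) * g0 x\<bar> \<le> c * \<bar>u - x\<bar>" "\<bar>G v - G x - (v - x) * g0 x\<bar> \<le> c * \<bar>v - x\<bar>"
          using d(2)[OF xab, of u] d(2)[OF xab, of v] uv by (auto simp: dist_real_def)
        moreover have "M i - D i = (G u - G x - (u - x) * g0 x) - (G v - G x - (v - x) * g0 x)"
          using uv unfolding xK M_def D_def by (simp add: algebra_simps)
        moreover have "c * \<bar>u - x\<bar> + c * \<bar>v - x\<bar> = c * (v - u)" using uv by (simp add: algebra_simps)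
        ultimately show ?thesis using uv xK by simp
      qed
      have exceptional: "(\<Sum>i\<in>P. \<bar>M i - D i\<bar>) < e / 2"
      proof -
        have PK: "\<exists>u v. snd i = {u..v} \<and> u \<le> v \<and> a \<le> u \<and> v \<le> b \<and> Inf (snd i) = u \<and> Sup (snd i) = v
                \<and> snd i \<subseteq> U" if "i \<in> P" for i
          using K[of "fst i" "snd i"] that by (force simp: P_def \<gamma>_def)
        have dj: "disjoint_family_on (\<lambda>i. {Inf (snd i)<..<Sup (snd i)}) P"
          unfolding disjoint_family_on_def
        proof (intro ballI impI)
          fix i j assume ij: "i \<in> P" "j \<in> P" "i \<noteq> j"
          have "interior (snd i) \<inter> interior (snd j) = {}"
            using tagged_division_ofD(5)[OF p', of "fst i" "snd i" "fst j" "snd j"] ij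
            by (auto simp: P_def prod_eq_iff)
          then show "{Inf (snd i)<..<Sup (snd i)} \<inter> {Inf (snd j)<..<Sup (snd j)} = {}"
            using PK[OF ij(1)] PK[OF ij(2)] by (metis interior_atLeastAtMost_real)
        qed
        have finP: "finite P" using fin by (simp add: P_def)
        have le: "Inf (snd i) \<le> Sup (snd i)" "{Inf (snd i)<..<Sup (snd i)} \<subseteq> U" if "i \<in> P" for i
          using PK[OF that] by auto
        have "(\<Sum>i\<in>P. Sup (snd i) - Inf (snd i)) = (\<Sum>i\<in>P. measure lebesgue {Inf (snd i)<..<Sup (snd i)})"
          using le by (intro sum.cong) auto
        also have "\<dots> = measure lebesgue (\<Union>i\<in>P. {Inf (snd i)<..<Sup (snd i)})"
          using finP dj le by (intro measure_finite_Union[symmetric]) auto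
        also have "\<dots> \<le> measure lebesgue U"
          using le(2) Um finP by (intro measure_mono_fmeasurable UN_least sets.finite_UN) auto
        finally have "(\<Sum>i\<in>P. Sup (snd i) - Inf (snd i)) < \<delta>" using Umes by simp
        then have "(\<Sum>i\<in>P. \<bar>G (Sup (snd i)) - G (Inf (snd i))\<bar>) < e / 2"
          using PK by (intro ac'[OF finP _ dj]) fastforce+
        moreover have "\<bar>M i - D i\<bar> = \<bar>G (Sup (snd i)) - G (Inf (snd i))\<bar>" if "i \<in> P" for i
          using that by (cases i) (auto simp: P_def M_def D_def g0_def abs_minus_commute)
        ultimately show ?thesis by simp
      qed
      have "(\<Sum>i\<in>p - P. \<bar>M i - D i\<bar>) \<le> (\<Sum>i\<in>p - P. c * (Sup (snd i) - Inf (snd i)))"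
        by (intro sum_mono good)
      also have "\<dots> \<le> (\<Sum>i\<in>p. c * (Sup (snd i) - Inf (snd i)))"
      proof (rule sum_mono2[OF fin])
        fix i assume "i \<in> p - (p - P)"
        then have "(fst i, snd i) \<in> p" by simp
        from K[OF this] show "0 \<le> c * (Sup (snd i) - Inf (snd i))" using c by auto
      qed auto
      also have "\<dots> = c * (b - a)" by (simp add: sum_distrib_left[symmetric] len)
      also have "\<dots> \<le> e / 2" using e ab by (simp add: c_def field_simps)
      finally have "(\<Sum>i\<in>p. \<bar>M i - D i\<bar>) < e"
        using exceptional sum.subset_diff[of P p "\<lambda>i. \<bar>M i - D i\<bar>"] fin by (auto simp: P_def)
      moreover have "(\<Sum>(x,K)\<in>p. measure lborel K *\<^sub>R g0 x) - (G b - G a) = (\<Sum>i\<in>p. M i - D i)"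
        unfolding total[symmetric] by (simp add: sum_subtractf M_def case_prod_unfold)
      moreover have "\<bar>\<Sum>i\<in>p. M i - D i\<bar> \<le> (\<Sum>i\<in>p. \<bar>M i - D i\<bar>)" by (rule sum_abs)
      ultimately show ?thesis unfolding real_norm_def by linarith
    qed
    ultimately show "\<exists>\<gamma>. gauge \<gamma> \<and> (\<forall>\<D>. \<D> tagged_division_of cbox a b \<and> \<gamma> fine \<D> \<longrightarrow>
        norm ((\<Sum>(x, K)\<in>\<D>. measure lborel K *\<^sub>R g0 x) - (G b - G a)) < e)" by (intro exI[of _ \<gamma>]) simp
  qed
  then have "(g0 has_integral (G b - G a)) {a..b}" by simp
  then show ?thesis
    by (rule has_integral_spike[OF E, rotated]) (simp add: g0_def)
qed

lemma AE_lebesgue_on_Ioo_iff: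
  fixes a b :: real
  shows "(AE x in lebesgue_on {a<..<b}. P x) \<longleftrightarrow> (\<exists>E. negligible E \<and> (\<forall>x\<in>{a<..<b} - E. P x))"
proof
  assume "AE x in lebesgue_on {a<..<b}. P x"
  then have "AE x in lebesgue. x \<in> {a<..<b} \<longrightarrow> P x" by (simp add: AE_restrict_space_iff)
  then obtain N where "N \<in> null_sets lebesgue" "{x. \<not> (x \<in> {a<..<b} \<longrightarrow> P x)} \<subseteq> N"
    by (auto simp: eventually_ae_filter)
  then show "\<exists>E. negligible E \<and> (\<forall>x\<in>{a<..<b} - E. P x)"
    by (intro exI[of _ N]) (auto simp: negligible_iff_null_sets)
next
  assume "\<exists>E. negligible E \<and> (\<forall>x\<in>{a<..<b} - E. P x)"
  then obtain E where E: "E \<in> null_sets lebesgue" "\<forall>x\<in>{a<..<b} - E. P x"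
    by (auto simp: negligible_iff_null_sets)
  have "AE x in lebesgue. x \<in> {a<..<b} \<longrightarrow> P x"
    using AE_not_in[OF E(1)] E(2) by (auto elim: eventually_mono)
  then show "AE x in lebesgue_on {a<..<b}. P x" by (simp add: AE_restrict_space_iff)
qed

text \<open>
  Serves to pass from an indefinite integral to \<open>\<phi> (u')\<close>, which differs from it by a sign and a
  constant and is controlled on the closed interval only.
\<close>

lemma abs_continuous_on_interval_transfer:
  assumes g: "abs_continuous_on_interval a b g"
    and eq: "\<And>x y. x \<in> {a..b} \<Longrightarrow> y \<in> {a..b} \<Longrightarrow> \<bar>h x - h y\<bar> = \<bar>g x - g y\<bar>"
  shows "abs_continuous_on_interval a b h"
  unfolding abs_continuous_on_interval_def
proof (intro allI impI)
  fix \<epsilon> :: real assume "\<epsilon> > 0"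
  then obtain \<delta> where \<delta>: "\<delta> > 0" "\<And>(N::nat) s t. (\<forall>i<N. a \<le> s i \<and> s i \<le> t i \<and> t i \<le> b) \<and>
      disjoint_family_on (\<lambda>i. {s i<..<t i}) {..<N} \<and> (\<Sum>i<N. t i - s i) < \<delta> \<Longrightarrow>
      (\<Sum>i<N. \<bar>g (t i) - g (s i)\<bar>) < \<epsilon>"
    using g unfolding abs_continuous_on_interval_def by meson
  show "\<exists>\<delta>>0. \<forall>(N::nat) s t. (\<forall>i<N. a \<le> s i \<and> s i \<le> t i \<and> t i \<le> b) \<and>
      disjoint_family_on (\<lambda>i. {s i<..<t i}) {..<N} \<and> (\<Sum>i<N. t i - s i) < \<delta> \<longrightarrow>
      (\<Sum>i<N. \<bar>h (t i) - h (s i)\<bar>) < \<epsilon>"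
  proof (intro exI[of _ \<delta>] conjI allI impI \<delta>(1))
    fix N :: nat and s t :: "nat \<Rightarrow> real"
    assume asm: "(\<forall>i<N. a \<le> s i \<and> s i \<le> t i \<and> t i \<le> b) \<and>
      disjoint_family_on (\<lambda>i. {s i<..<t i}) {..<N} \<and> (\<Sum>i<N. t i - s i) < \<delta>"
    have "\<bar>h (t i) - h (s i)\<bar> = \<bar>g (t i) - g (s i)\<bar>" if i: "i < N" for i
    proof (rule eq)
      have "a \<le> s i" "s i \<le> t i" "t i \<le> b" using asm i by blast+
      then show "t i \<in> {a..b}" "s i \<in> {a..b}" by auto
    qed
    then have "(\<Sum>i<N. \<bar>h (t i) - h (s i)\<bar>) = (\<Sum>i<N. \<bar>g (t i) - g (s i)\<bar>)"
      by (intro sum.cong) auto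
    then show "(\<Sum>i<N. \<bar>h (t i) - h (s i)\<bar>) < \<epsilon>" using \<delta>(2)[OF asm] by simp
  qed
qed

lemma abs_continuous_on_interval_subset:
  assumes "abs_continuous_on_interval a b g" "c \<le> b"
  shows "abs_continuous_on_interval a c g"
  using assms unfolding abs_continuous_on_interval_def by (meson order_trans)

section \<open>Concave profiles\<close>

locale phi_laplacian =
  fixes a b :: real and \<phi> :: "real \<Rightarrow> real"
  assumes ab: "a < b"
    and phi_odd: "\<And>x. \<phi> (- x) = - \<phi> x"
    and phi_mono: "strict_mono \<phi>"
    and phi_homeo: "homeomorphism UNIV UNIV \<phi> (inv \<phi>)"
begin

definition psi :: "real \<Rightarrow> real" where "psi = inv \<phi>"

lemma psi_phi [simp]: "psi (\<phi> x) = x" and phi_psi [simp]: "\<phi> (psi y) = y"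
  using phi_homeo unfolding homeomorphism_def psi_def by auto

lemma continuous_psi: "continuous_on S psi"
  using phi_homeo unfolding homeomorphism_def psi_def by (meson continuous_on_subset subset_UNIV)

lemma phi_less_iff [simp]: "\<phi> x < \<phi> y \<longleftrightarrow> x < y" and phi_le_iff [simp]: "\<phi> x \<le> \<phi> y \<longleftrightarrow> x \<le> y"
  using phi_mono by (simp_all add: strict_mono_less strict_mono_less_eq)

lemma psi_less_iff [simp]: "psi x < psi y \<longleftrightarrow> x < y" and psi_le_iff [simp]: "psi x \<le> psi y \<longleftrightarrow> x \<le> y"
  using phi_less_iff[of "psi x" "psi y"] phi_le_iff[of "psi x" "psi y"] by simp_all

lemma phi_0 [simp]: "\<phi> 0 = 0"
  using phi_odd[of 0] by simp

lemma psi_0 [simp]: "psi 0 = 0"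
  using psi_phi[of 0] by simp

lemma psi_minus: "psi (- y) = - psi y"
  by (metis phi_odd phi_psi psi_phi)

lemma psi_pos_iff [simp]: "0 < psi y \<longleftrightarrow> 0 < y" and psi_nonneg_iff [simp]: "0 \<le> psi y \<longleftrightarrow> 0 \<le> y"
  and psi_neg_iff [simp]: "psi y < 0 \<longleftrightarrow> y < 0"
  using psi_less_iff[of 0 y] psi_le_iff[of 0 y] psi_less_iff[of y 0] by simp_all

lemma phi_pos_iff [simp]: "0 < \<phi> y \<longleftrightarrow> 0 < y"
  using phi_less_iff[of 0 y] by simp

lemma abs_psi_le: "\<bar>y\<bar> \<le> z \<Longrightarrow> \<bar>psi y\<bar> \<le> psi z"
  using psi_le_iff[of y z] psi_le_iff[of "- y" z] psi_minus[of y] by (simp add: abs_le_iff del: psi_le_iff)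

text \<open>
  For a solution of \<open>- \<phi>(u')' = h\<close> with \<open>u a = 0\<close> and \<open>\<phi> (u' a) = s\<close>, the flux is \<open>\<phi> (u')\<close> and the
  profile is \<open>u\<close>.
\<close>

definition flux :: "real \<Rightarrow> (real \<Rightarrow> real) \<Rightarrow> real \<Rightarrow> real" where
  "flux s h t = s - integral {a..t} h"

definition profile :: "real \<Rightarrow> (real \<Rightarrow> real) \<Rightarrow> real \<Rightarrow> real" where
  "profile s h x = integral {a..x} (\<lambda>t. psi (flux s h t))"

definition bdist :: "real \<Rightarrow> real" where
  "bdist x = min (x - a) (b - x)"

lemma profile_a [simp]: "profile s h a = 0"
  by (simp add: profile_def)

lemma flux_a [simp]: "flux s h a = s"
  by (simp add: flux_def)

lemma profile_cong:
  assumes "\<And>t. t \<in> {a..x} \<Longrightarrow> h t = k t"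
  shows "profile s h x = profile s k x"
proof -
  have "integral {a..t} h = integral {a..t} k" if "t \<in> {a..x}" for t
    using assms that by (intro Henstock_Kurzweil_Integration.integral_cong) auto
  then show ?thesis
    unfolding profile_def flux_def by (intro Henstock_Kurzweil_Integration.integral_cong) auto
qed

lemma continuous_flux: "h integrable_on {a..b} \<Longrightarrow> continuous_on {a..b} (flux s h)"
  unfolding flux_def by (intro continuous_intros indefinite_integral_continuous_1)

lemma flux_diff:
  assumes "h integrable_on {a..b}" "a \<le> x" "x \<le> y" "y \<le> b"
  shows "flux s h x - flux s h y = integral {x..y} h"
proof -
  have "integral {a..x} h + integral {x..y} h = integral {a..y} h"
    using assms by (intro Henstock_Kurzweil_Integration.integral_combine integrable_on_subinterval[OF assms(1)]) auto
  then show ?thesis by (simp add: flux_def)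
qed

lemma profile_has_derivative:
  assumes "h integrable_on {a..b}" "x \<in> {a..b}"
  shows "(profile s h has_real_derivative psi (flux s h x)) (at x within {a..b})"
proof -
  have "continuous_on {a..b} (\<lambda>t. psi (flux s h t))"
    using continuous_on_compose2[OF continuous_psi continuous_flux[OF assms(1)]] by auto
  then show ?thesis
    unfolding profile_def[abs_def] has_real_derivative_iff_has_vector_derivative
    by (intro integral_has_vector_derivative assms)
qed

lemma continuous_profile: "h integrable_on {a..b} \<Longrightarrow> continuous_on {a..b} (profile s h)"
  by (rule DERIV_continuous_on[OF profile_has_derivative])

lemma flux_antimono:
  assumes h: "h integrable_on {a..b}" and nonneg: "\<And>t. t \<in> {a..b} \<Longrightarrow> 0 \<le> h t"
    and xy: "a \<le> x" "x \<le> y" "y \<le> b"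
  shows "flux s h y \<le> flux s h x"
proof -
  have "0 \<le> integral {x..y} h"
    using xy nonneg by (intro integral_nonneg integrable_on_subinterval[OF h]) auto
  then show ?thesis using flux_diff[OF h xy, of s] by simp
qed

lemma flux_ge:
  assumes h: "h integrable_on {a..b}" and nonneg: "\<And>t. t \<in> {a..b} \<Longrightarrow> 0 \<le> h t"
    and x: "x \<in> {a..b}"
  shows "s - integral {a..b} h \<le> flux s h x"
  using flux_antimono[OF h nonneg, of x b s] x by (simp add: flux_def)

lemma flux_le:
  assumes h: "h integrable_on {a..b}" and nonneg: "\<And>t. t \<in> {a..b} \<Longrightarrow> 0 \<le> h t"
    and x: "x \<in> {a..b}"
  shows "flux s h x \<le> s"
  using flux_antimono[OF h nonneg, of a x s] x by simp

lemma profile_increment: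
  assumes h: "h integrable_on {a..b}" and xy: "a \<le> x" "x < y" "y \<le> b"
  obtains z where "x < z" "z < y" "profile s h y - profile s h x = (y - x) * psi (flux s h z)"
proof -
  have "\<exists>z\<in>{x<..<y}. profile s h y - profile s h x = (*) (psi (flux s h z)) (y - x)"
  proof (rule mvt_simple)
    show "(profile s h has_derivative (*) (psi (flux s h z))) (at z within {x..y})" if "x \<le> z" "z \<le> y" for z
      using has_field_derivative_subset[OF profile_has_derivative[OF h, of z s], of "{x..y}"] that xy
      by (simp add: has_field_derivative_def)
  qed (use xy in auto)
  then show thesis using that by (auto simp: mult.commute)
qed

text \<open>
  The slope of the profile is \<open>psi\<close> of the flux, which is nonincreasing since \<open>h \<ge> 0\<close>: the profile is
  concave. All later shape estimates start from this inequality.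
\<close>

lemma profile_le_tangent:
  assumes h: "h integrable_on {a..b}" and nonneg: "\<And>t. t \<in> {a..b} \<Longrightarrow> 0 \<le> h t"
    and x: "x \<in> {a..b}" and y: "y \<in> {a..b}"
  shows "profile s h y \<le> profile s h x + (y - x) * psi (flux s h x)"
proof (rule linorder_cases[of x y])
  assume "x < y"
  then obtain z where z: "x < z" "z < y" "profile s h y - profile s h x = (y - x) * psi (flux s h z)"
    using profile_increment[OF h, of x y s] x y by auto
  have "flux s h z \<le> flux s h x" using x y z by (intro flux_antimono[OF h nonneg]) auto
  then have "(y - x) * psi (flux s h z) \<le> (y - x) * psi (flux s h x)"
    using \<open>x < y\<close> by (intro mult_left_mono) auto
  then show ?thesis using z by linarith
next
  assume "y < x"
  then obtain z where z: "y < z" "z < x" "profile s h x - profile s h y = (x - y) * psi (flux s h z)"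
    using profile_increment[OF h, of y x s] x y by auto
  have "flux s h x \<le> flux s h z" using x y z by (intro flux_antimono[OF h nonneg]) auto
  then have "(x - y) * psi (flux s h x) \<le> (x - y) * psi (flux s h z)"
    using \<open>y < x\<close> by (intro mult_left_mono) auto
  then show ?thesis using z by (simp add: algebra_simps)
qed simp

lemma profile_chord:
  assumes h: "h integrable_on {a..b}" and nonneg: "\<And>t. t \<in> {a..b} \<Longrightarrow> 0 \<le> h t"
    and le: "a \<le> x" "x \<le> y" "y \<le> z" "z \<le> b"
  shows "(z - y) * profile s h x + (y - x) * profile s h z \<le> (z - x) * profile s h y"
proof -
  let ?u = "profile s h" and ?d = "psi (flux s h y)"
  have "(z - y) * ?u x \<le> (z - y) * (?u y + (x - y) * ?d)"
    using le by (intro mult_left_mono profile_le_tangent[OF h nonneg]) auto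
  moreover have "(y - x) * ?u z \<le> (y - x) * (?u y + (z - y) * ?d)"
    using le by (intro mult_left_mono profile_le_tangent[OF h nonneg]) auto
  moreover have "(z - y) * (?u y + (x - y) * ?d) + (y - x) * (?u y + (z - y) * ?d) = (z - x) * ?u y"
    by (simp add: algebra_simps)
  ultimately show ?thesis by linarith
qed

lemma profile_nonneg:
  assumes h: "h integrable_on {a..b}" and nonneg: "\<And>t. t \<in> {a..b} \<Longrightarrow> 0 \<le> h t"
    and end_ge: "0 \<le> profile s h b" and x: "x \<in> {a..b}"
  shows "0 \<le> profile s h x"
proof -
  have "0 \<le> (x - a) * profile s h b" using x end_ge by simp
  also have "\<dots> \<le> (b - a) * profile s h x"
    using profile_chord[OF h nonneg, of a x b s] x by simp
  finally show ?thesis using ab by (simp add: zero_le_mult_iff)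
qed

text \<open>
  A concave function that is nonnegative at both end points lies above the chords that join its
  value at \<open>z\<close> to zero at the end points.
\<close>

lemma profile_ge_bdist:
  assumes h: "h integrable_on {a..b}" and nonneg: "\<And>t. t \<in> {a..b} \<Longrightarrow> 0 \<le> h t"
    and end_ge: "0 \<le> profile s h b" and x: "x \<in> {a..b}" and z: "z \<in> {a..b}"
  shows "profile s h z * bdist x \<le> (b - a) * profile s h x"
proof -
  let ?u = "profile s h"
  have pos: "0 \<le> ?u t" if "t \<in> {a..b}" for t
    by (rule profile_nonneg[OF h nonneg end_ge that])
  show ?thesis
  proof (cases "x \<le> z")
    case True
    have "?u z * bdist x \<le> ?u z * (x - a)"
      using pos[OF z] by (intro mult_left_mono) (auto simp: bdist_def)
    also have "\<dots> \<le> (z - a) * ?u x"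
      using profile_chord[OF h nonneg, of a x z s] x z True by (simp add: mult.commute)
    also have "\<dots> \<le> (b - a) * ?u x"
      using z pos[OF x] by (intro mult_right_mono) auto
    finally show ?thesis .
  next
    case False
    have "?u z * bdist x \<le> ?u z * (b - x)"
      using pos[OF z] by (intro mult_left_mono) (auto simp: bdist_def)
    also have "\<dots> \<le> (b - x) * ?u z + (x - z) * ?u b"
      using end_ge False by (simp add: mult.commute)
    also have "\<dots> \<le> (b - z) * ?u x"
      using x z False by (intro profile_chord[OF h nonneg]) auto
    also have "\<dots> \<le> (b - a) * ?u x"
      using z pos[OF x] by (intro mult_right_mono) auto
    finally show ?thesis .
  qed
qed

lemma profile_le_initial_slope:
  assumes h: "h integrable_on {a..b}" and nonneg: "\<And>t. t \<in> {a..b} \<Longrightarrow> 0 \<le> h t"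
    and s: "s \<le> S" "0 \<le> S" and x: "x \<in> {a..b}"
  shows "profile s h x \<le> (b - a) * psi S"
proof -
  have "profile s h x \<le> (x - a) * psi s"
    using profile_le_tangent[OF h nonneg, of a x s] x by simp
  also have "\<dots> \<le> (x - a) * psi S" using s x by (intro mult_left_mono) auto
  also have "\<dots> \<le> (b - a) * psi S" using s x by (intro mult_right_mono) auto
  finally show ?thesis .
qed

text \<open>
  The slope is smallest at the right end point, where the flux is \<open>s\<close> minus the whole mass of \<open>h\<close>.
\<close>

lemma profile_end_ge:
  assumes h: "h integrable_on {a..b}" and nonneg: "\<And>t. t \<in> {a..b} \<Longrightarrow> 0 \<le> h t"
  shows "(b - a) * psi (s - integral {a..b} h) \<le> profile s h b"
proof -
  have "profile s h a \<le> profile s h b + (a - b) * psi (flux s h b)"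
    using ab by (intro profile_le_tangent[OF h nonneg]) auto
  then show ?thesis by (simp add: flux_def algebra_simps)
qed

text \<open>
  The flux drops by at least \<open>J\<close> between \<open>a + d\<close> and \<open>b - d\<close>, so it is at least \<open>J / 2\<close> at the first
  point or at most \<open>- J / 2\<close> at the second. By concavity the slope is even steeper between that point
  and the adjacent end point, at distance \<open>d\<close>, which gives the height \<open>d * psi (J / 2)\<close> there.
\<close>

lemma profile_lower_bound:
  assumes h: "h integrable_on {a..b}" and nonneg: "\<And>t. t \<in> {a..b} \<Longrightarrow> 0 \<le> h t"
    and end0: "profile s h b = 0" and d: "0 < d" "2 * d < b - a" and x: "x \<in> {a..b}"
    and J: "J \<le> integral {a + d..b - d} h"
  shows "d * psi (J / 2) * bdist x \<le> (b - a) * profile s h x"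
proof -
  let ?w = "flux s h"
  have "?w (a + d) - ?w (b - d) \<ge> J"
    using flux_diff[OF h, of "a + d" "b - d" s] d J by simp
  then have "J / 2 \<le> ?w (a + d) \<or> J / 2 \<le> - ?w (b - d)" by linarith
  then obtain z where z: "z \<in> {a..b}" "d * psi (J / 2) \<le> profile s h z"
  proof
    assume J1: "J / 2 \<le> ?w (a + d)"
    have "profile s h a \<le> profile s h (a + d) + (a - (a + d)) * psi (?w (a + d))"
      using d by (intro profile_le_tangent[OF h nonneg]) auto
    moreover have "d * psi (J / 2) \<le> d * psi (?w (a + d))" using d J1 by simp
    ultimately have "d * psi (J / 2) \<le> profile s h (a + d)" by simp
    then show thesis using that[of "a + d"] d by simp
  next
    assume J2: "J / 2 \<le> - ?w (b - d)"
    have "profile s h b \<le> profile s h (b - d) + (b - (b - d)) * psi (?w (b - d))"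
      using d by (intro profile_le_tangent[OF h nonneg]) auto
    moreover have "d * psi (J / 2) \<le> d * psi (- ?w (b - d))" using d J2 by simp
    ultimately have "d * psi (J / 2) \<le> profile s h (b - d)" using end0 by (simp add: psi_minus)
    then show thesis using that[of "b - d"] d by simp
  qed
  have "d * psi (J / 2) * bdist x \<le> profile s h z * bdist x"
    using z x by (intro mult_right_mono) (auto simp: bdist_def)
  also have "\<dots> \<le> (b - a) * profile s h x"
    using end0 by (intro profile_ge_bdist[OF h nonneg] x z) auto
  finally show ?thesis .
qed

text \<open>
  Suppose that the first profile exceeds the second at \<open>z\<close>. Around \<open>z\<close>, up to the nearest points where
  it does not, \<open>h \<le> k\<close> holds, so the difference of the fluxes is nondecreasing. But this difference
  is positive somewhere to the left of \<open>z\<close>, where the difference of the profiles has to grow, and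
  negative somewhere to the right.
\<close>

lemma profile_comparison:
  assumes h: "h integrable_on {a..b}" and k: "k integrable_on {a..b}"
    and end_le: "profile s h b \<le> profile \<sigma> k b"
    and le: "\<And>x. x \<in> {a..b} \<Longrightarrow> profile \<sigma> k x < profile s h x \<Longrightarrow> h x \<le> k x"
    and z: "z \<in> {a..b}"
  shows "profile s h z \<le> profile \<sigma> k z"
proof (rule ccontr)
  define D where "D x = profile s h x - profile \<sigma> k x" for x
  assume "\<not> ?thesis"
  then have Dz: "0 < D z" by (simp add: D_def)
  have Dc: "continuous_on {a..b} D" unfolding D_def[abs_def] by (intro continuous_intros continuous_profile h k)
  have Dd: "(D has_real_derivative psi (flux s h x) - psi (flux \<sigma> k x)) (at x within {a..b})"
    if "x \<in> {a..b}" for x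
    unfolding D_def[abs_def] by (intro DERIV_diff profile_has_derivative h k that)
  have mvt: "\<exists>\<xi>. x < \<xi> \<and> \<xi> < y \<and> D y - D x = (y - x) * (psi (flux s h \<xi>) - psi (flux \<sigma> k \<xi>))"
    if xy: "a \<le> x" "x < y" "y \<le> b" for x y
  proof -
    have "\<exists>\<xi>\<in>{x<..<y}. D y - D x = (*) (psi (flux s h \<xi>) - psi (flux \<sigma> k \<xi>)) (y - x)"
    proof (rule mvt_simple)
      show "(D has_derivative (*) (psi (flux s h t) - psi (flux \<sigma> k t))) (at t within {x..y})"
        if "x \<le> t" "t \<le> y" for t
        using has_field_derivative_subset[OF Dd[of t], of "{x..y}"] that xy
        by (simp add: has_field_derivative_def)
    qed (use xy in auto)
    then show ?thesis by (auto simp: mult.commute)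
  qed
  have cpt: "compact {x\<in>{l..r}. D x \<le> 0}" if "a \<le> l" "r \<le> b" for l r
  proof -
    have "closed ({l..r} \<inter> D -` {..0})"
      using that by (intro continuous_closed_preimage continuous_on_subset[OF Dc]) auto
    moreover have "{l..r} \<inter> D -` {..0} = {x\<in>{l..r}. D x \<le> 0}" by auto
    moreover have "bounded {x\<in>{l..r}. D x \<le> 0}"
      by (rule bounded_subset[OF bounded_closed_interval[of l r]]) auto
    ultimately show ?thesis by (simp add: compact_eq_bounded_closed)
  qed
  obtain c where c: "c \<in> {a..z}" "D c \<le> 0" "\<And>x. x \<in> {a..z} \<Longrightarrow> D x \<le> 0 \<Longrightarrow> x \<le> c"
    using compact_attains_sup[OF cpt[of a z]] z by (force simp: D_def)
  obtain e where e: "e \<in> {z..b}" "D e \<le> 0" "\<And>x. x \<in> {z..b} \<Longrightarrow> D x \<le> 0 \<Longrightarrow> e \<le> x"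
    using compact_attains_inf[OF cpt[of z b]] z end_le by (force simp: D_def)
  have "c < z" "z < e" using c e Dz by (auto simp: less_le)
  obtain \<xi> where \<xi>: "c < \<xi>" "\<xi> < z" "D z - D c = (z - c) * (psi (flux s h \<xi>) - psi (flux \<sigma> k \<xi>))"
    using mvt[of c z] c z \<open>c < z\<close> by auto
  obtain \<eta> where \<eta>: "z < \<eta>" "\<eta> < e" "D e - D z = (e - z) * (psi (flux s h \<eta>) - psi (flux \<sigma> k \<eta>))"
    using mvt[of z e] e z \<open>z < e\<close> by auto
  have "0 < (z - c) * (psi (flux s h \<xi>) - psi (flux \<sigma> k \<xi>))" using \<xi>(3) Dz c(2) by linarith
  then have 1: "flux \<sigma> k \<xi> < flux s h \<xi>" using \<open>c < z\<close> by (simp add: zero_less_mult_iff)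
  have "(e - z) * (psi (flux s h \<eta>) - psi (flux \<sigma> k \<eta>)) < 0" using \<eta>(3) Dz e(2) by linarith
  then have 2: "flux s h \<eta> < flux \<sigma> k \<eta>" using \<open>z < e\<close> by (simp add: mult_less_0_iff)
  have order: "a \<le> \<xi>" "\<xi> \<le> \<eta>" "\<eta> \<le> b" using \<xi> \<eta> c e by auto
  have "integral {\<xi>..\<eta>} h \<le> integral {\<xi>..\<eta>} k"
  proof (rule integral_le)
    show "h integrable_on {\<xi>..\<eta>}" using order by (intro integrable_on_subinterval[OF h]) auto
    show "k integrable_on {\<xi>..\<eta>}" using order by (intro integrable_on_subinterval[OF k]) auto
    fix x assume x: "x \<in> {\<xi>..\<eta>}"
    have "0 < D x"
    proof (rule ccontr)
      assume "\<not> 0 < D x"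
      then have "D x \<le> 0" by simp
      then show False
        using c(3)[of x] e(3)[of x] x \<xi> \<eta> order by (cases "x \<le> z") auto
    qed
    then show "h x \<le> k x" using x order by (intro le) (auto simp: D_def)
  qed
  then show False
    using 1 2 flux_diff[OF h order, of s] flux_diff[OF k order, of \<sigma>] by linarith
qed

section \<open>Shooting through delayed problems\<close>

text \<open>
  Instead of joint measurability of \<open>F\<close>, integrability is required along every continuous function,
  which is all that the integral equation uses.
\<close>

definition caratheodory :: "(real \<Rightarrow> real \<Rightarrow> real) \<Rightarrow> (real \<Rightarrow> real) \<Rightarrow> bool" where
  "caratheodory F K \<longleftrightarrow> K integrable_on {a..b} \<and>
     (\<forall>x\<in>{a..b}. continuous_on UNIV (F x) \<and> (\<forall>y. 0 \<le> F x y \<and> F x y \<le> K x)) \<and>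
     (\<forall>v. continuous_on {a..b} v \<longrightarrow> (\<lambda>x. F x (v x)) integrable_on {a..b})"

definition ivp :: "(real \<Rightarrow> real \<Rightarrow> real) \<Rightarrow> real \<Rightarrow> (real \<Rightarrow> real) \<Rightarrow> bool" where
  "ivp F s u \<longleftrightarrow> continuous_on {a..b} u \<and> (\<forall>x\<in>{a..b}. u x = profile s (\<lambda>t. F t (u t)) x)"

text \<open>
  The method of steps for \<open>u = profile s (\<lambda>t. F t (u (max a (t - \<delta>))))\<close>: each integration determines
  \<open>u\<close> on a further interval of length \<open>\<delta>\<close>, so that iterates beyond \<open>(b - a) / \<delta>\<close> solve the equation.
\<close>

primrec delayed :: "(real \<Rightarrow> real \<Rightarrow> real) \<Rightarrow> real \<Rightarrow> real \<Rightarrow> nat \<Rightarrow> real \<Rightarrow> real" where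
  "delayed F \<delta> s 0 = (\<lambda>x. 0)"
| "delayed F \<delta> s (Suc k) = profile s (\<lambda>t. F t (delayed F \<delta> s k (max a (t - \<delta>))))"

lemma caratheodory_integrable:
  "caratheodory F K \<Longrightarrow> continuous_on {a..b} v \<Longrightarrow> (\<lambda>x. F x (v x)) integrable_on {a..b}"
  by (simp add: caratheodory_def)

lemma caratheodory_bounds:
  "caratheodory F K \<Longrightarrow> x \<in> {a..b} \<Longrightarrow> 0 \<le> F x y" "caratheodory F K \<Longrightarrow> x \<in> {a..b} \<Longrightarrow> F x y \<le> K x"
  by (simp_all add: caratheodory_def)

lemma continuous_shift: "continuous_on {a..b} v \<Longrightarrow> 0 \<le> \<delta> \<Longrightarrow> continuous_on {a..b} (\<lambda>t. v (max a (t - \<delta>)))"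
  by (rule continuous_on_compose2[of "{a..b}" v]) (auto intro!: continuous_intros)

lemma abs_flux_le:
  assumes h: "h integrable_on {a..b}" and nonneg: "\<And>t. t \<in> {a..b} \<Longrightarrow> 0 \<le> h t"
    and K: "K integrable_on {a..b}" and le: "\<And>t. t \<in> {a..b} \<Longrightarrow> h t \<le> K t"
    and s: "\<bar>s\<bar> \<le> S" and x: "x \<in> {a..b}"
  shows "\<bar>flux s h x\<bar> \<le> S + integral {a..b} K"
proof -
  have "0 \<le> integral {a..b} h" "integral {a..b} h \<le> integral {a..b} K"
    using nonneg le by (auto intro: integral_nonneg[OF h] integral_le[OF h K])
  then show ?thesis using flux_ge[OF h nonneg x, of s] flux_le[OF h nonneg x, of s] s by linarith
qed

lemma profile_lipschitz:
  assumes h: "h integrable_on {a..b}" and nonneg: "\<And>t. t \<in> {a..b} \<Longrightarrow> 0 \<le> h t"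
    and K: "K integrable_on {a..b}" and le: "\<And>t. t \<in> {a..b} \<Longrightarrow> h t \<le> K t"
    and s: "\<bar>s\<bar> \<le> S" and xy: "x \<in> {a..b}" "y \<in> {a..b}"
  shows "\<bar>profile s h x - profile s h y\<bar> \<le> psi (S + integral {a..b} K) * \<bar>x - y\<bar>"
proof -
  have d: "\<bar>psi (flux s h t)\<bar> \<le> psi (S + integral {a..b} K)" if "t \<in> {a..b}" for t
    by (intro abs_psi_le abs_flux_le[OF h nonneg K le s that])
  have one: "profile s h v - profile s h u \<le> psi (S + integral {a..b} K) * \<bar>u - v\<bar>"
    if "u \<in> {a..b}" "v \<in> {a..b}" for u v
  proof -
    have "profile s h v - profile s h u \<le> (v - u) * psi (flux s h u)"
      using profile_le_tangent[OF h nonneg that, of s] by simp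
    also have "\<dots> \<le> \<bar>v - u\<bar> * \<bar>psi (flux s h u)\<bar>"
      using abs_ge_self[of "(v - u) * psi (flux s h u)"] by (simp add: abs_mult)
    also have "\<dots> \<le> \<bar>v - u\<bar> * psi (S + integral {a..b} K)"
      using d[OF that(1)] by (intro mult_left_mono) auto
    finally show ?thesis by (simp add: mult.commute abs_minus_commute)
  qed
  show ?thesis using one[OF xy] one[OF xy(2,1)] by (simp add: abs_le_iff abs_minus_commute)
qed

text \<open>
  Dominated convergence for the inner integral, then for the outer one.
\<close>

lemma profile_tendsto:
  assumes K: "K integrable_on {a..b}"
    and h: "\<And>j::nat. h j integrable_on {a..b}"
    and bounds: "\<And>j t. t \<in> {a..b} \<Longrightarrow> 0 \<le> h j t \<and> h j t \<le> K t"
    and lim: "\<And>t. t \<in> {a..b} \<Longrightarrow> (\<lambda>j. h j t) \<longlonglongrightarrow> h' t"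
    and s: "\<sigma> \<longlonglongrightarrow> s'" and x: "x \<in> {a..b}"
  shows "(\<lambda>j. profile (\<sigma> j) (h j) x) \<longlonglongrightarrow> profile s' h' x"
proof -
  obtain S where S: "\<And>j. \<bar>\<sigma> j\<bar> \<le> S"
    using convergent_imp_Bseq[of \<sigma>] s by (auto simp: convergent_def Bseq_def)
  have fl: "(\<lambda>j. flux (\<sigma> j) (h j) t) \<longlonglongrightarrow> flux s' h' t" if t: "t \<in> {a..b}" for t
    unfolding flux_def
  proof (intro tendsto_diff s dominated_convergence(2)[where h = K])
    show "h j integrable_on {a..t}" for j using t by (intro integrable_on_subinterval[OF h]) auto
    show "K integrable_on {a..t}" using t by (intro integrable_on_subinterval[OF K]) auto
  qed (use t bounds lim in auto)
  have co: "continuous_on {a..b} (\<lambda>t. psi (flux (\<sigma> j) (h j) t))" for j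
    using continuous_on_compose2[OF continuous_psi continuous_flux[OF h[of j]]] by auto
  show ?thesis
    unfolding profile_def
  proof (rule dominated_convergence(2)[where h = "\<lambda>_. psi (S + integral {a..b} K)"])
    show "(\<lambda>t. psi (flux (\<sigma> j) (h j) t)) integrable_on {a..x}" for j
      using x by (intro integrable_continuous_interval continuous_on_subset[OF co]) auto
    show "norm (psi (flux (\<sigma> j) (h j) t)) \<le> psi (S + integral {a..b} K)" if "t \<in> {a..x}" for j t
      using that x bounds unfolding real_norm_def
      by (intro abs_psi_le abs_flux_le[OF h _ K _ S]) auto
    show "(\<lambda>j. psi (flux (\<sigma> j) (h j) t)) \<longlonglongrightarrow> psi (flux s' h' t)" if "t \<in> {a..x}" for t
      using that x by (intro continuous_on_tendsto_compose[OF continuous_psi[of UNIV] fl]) auto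
  qed auto
qed

lemma continuous_delayed:
  assumes F: "caratheodory F K" and \<delta>: "0 \<le> \<delta>"
  shows "continuous_on {a..b} (delayed F \<delta> s k)"
proof (induction k)
  case (Suc k)
  show ?case
    by (simp, rule continuous_profile, rule caratheodory_integrable[OF F], rule continuous_shift[OF Suc \<delta>])
qed auto

lemma delayed_stable:
  assumes \<delta>: "0 < \<delta>"
  shows "x \<in> {a..b} \<Longrightarrow> x \<le> a + real k * \<delta> \<Longrightarrow> delayed F \<delta> s (Suc k) x = delayed F \<delta> s k x"
proof (induction k arbitrary: x)
  case 0
  then have "x = a" by simp
  show ?case unfolding \<open>x = a\<close> by simp
next
  case (Suc k)
  have "profile s (\<lambda>t. F t (delayed F \<delta> s (Suc k) (max a (t - \<delta>)))) x
      = profile s (\<lambda>t. F t (delayed F \<delta> s k (max a (t - \<delta>)))) x"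
  proof (rule profile_cong)
    fix t assume t: "t \<in> {a..x}"
    have "max a (t - \<delta>) \<in> {a..b}" using t Suc.prems(1) \<delta> by auto
    moreover have "max a (t - \<delta>) \<le> a + real k * \<delta>"
      using t Suc.prems(2) \<delta> by (auto simp: algebra_simps)
    ultimately show "F t (delayed F \<delta> s (Suc k) (max a (t - \<delta>))) = F t (delayed F \<delta> s k (max a (t - \<delta>)))"
      by (simp only: Suc.IH)
  qed
  then show ?case by simp
qed

lemma delayed_tendsto:
  assumes F: "caratheodory F K" and \<delta>: "0 \<le> \<delta>" and s: "\<sigma> \<longlonglongrightarrow> s'"
  shows "x \<in> {a..b} \<Longrightarrow> (\<lambda>j. delayed F \<delta> (\<sigma> j) k x) \<longlonglongrightarrow> delayed F \<delta> s' k x"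
proof (induction k arbitrary: x)
  case (Suc k)
  let ?h = "\<lambda>j t. F t (delayed F \<delta> (\<sigma> j) k (max a (t - \<delta>)))"
  have "(\<lambda>j. profile (\<sigma> j) (?h j) x) \<longlonglongrightarrow> profile s' (\<lambda>t. F t (delayed F \<delta> s' k (max a (t - \<delta>)))) x"
  proof (rule profile_tendsto[OF _ _ _ _ s Suc.prems])
    show "K integrable_on {a..b}" using F by (simp add: caratheodory_def)
    show "?h j integrable_on {a..b}" for j
      by (intro caratheodory_integrable[OF F] continuous_shift continuous_delayed[OF F] \<delta>)
    show "0 \<le> ?h j t \<and> ?h j t \<le> K t" if "t \<in> {a..b}" for j t
      using caratheodory_bounds[OF F that] by auto
    show "(\<lambda>j. ?h j t) \<longlonglongrightarrow> F t (delayed F \<delta> s' k (max a (t - \<delta>)))" if "t \<in> {a..b}" for t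
    proof (rule continuous_on_tendsto_compose[of UNIV "F t"])
      show "continuous_on UNIV (F t)" using F that by (simp add: caratheodory_def)
      show "(\<lambda>j. delayed F \<delta> (\<sigma> j) k (max a (t - \<delta>))) \<longlonglongrightarrow> delayed F \<delta> s' k (max a (t - \<delta>))"
        using that \<delta> ab by (intro Suc.IH) auto
    qed auto
  qed
  then show ?case by simp
qed auto

text \<open>
  The common Lipschitz constant gives a uniformly convergent subsequence, and it also makes the
  delayed and the undelayed arguments of \<open>F\<close> agree in the limit.
\<close>

lemma delayed_limit_is_ivp:
  assumes F: "caratheodory F K"
    and s: "\<And>n. \<bar>\<sigma> n\<bar> \<le> S"
    and d: "\<And>n. 0 \<le> \<delta> n" "\<delta> \<longlonglongrightarrow> 0"
    and uc: "\<And>n::nat. continuous_on {a..b} (u n)"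
    and u: "\<And>n x. x \<in> {a..b} \<Longrightarrow> u n x = profile (\<sigma> n) (\<lambda>t. F t (u n (max a (t - \<delta> n)))) x"
  obtains r s' v where "strict_mono (r :: nat \<Rightarrow> nat)" "(\<lambda>n. \<sigma> (r n)) \<longlonglongrightarrow> s'"
    "(\<lambda>n. u (r n) b) \<longlonglongrightarrow> v b" "ivp F s' v"
proof -
  let ?h = "\<lambda>n t. F t (u n (max a (t - \<delta> n)))"
  let ?L = "psi (S + integral {a..b} K)"
  have K: "K integrable_on {a..b}" using F by (simp add: caratheodory_def)
  have hint: "?h n integrable_on {a..b}" for n
    by (intro caratheodory_integrable[OF F] continuous_shift uc d)
  have hb: "0 \<le> ?h n t \<and> ?h n t \<le> K t" if "t \<in> {a..b}" for n t
    using caratheodory_bounds[OF F that] by auto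
  have lip: "\<bar>u n x - u n y\<bar> \<le> ?L * \<bar>x - y\<bar>" if "x \<in> {a..b}" "y \<in> {a..b}" for n x y
    unfolding u[OF that(1)] u[OF that(2)]
    using hb by (intro profile_lipschitz[OF hint _ K _ s that]) auto
  have "0 \<le> S" using s[of 0] by linarith
  moreover have "0 \<le> integral {a..b} K" using hb by (intro integral_nonneg[OF K]) force
  ultimately have L0: "0 \<le> ?L" by simp
  then have L1: "0 < ?L + 1" by linarith
  obtain r1 s' where r1: "strict_mono (r1 :: nat \<Rightarrow> nat)" "(\<lambda>n. \<sigma> (r1 n)) \<longlonglongrightarrow> s'"
  proof -
    have "\<forall>n. \<sigma> n \<in> {-S..S}" using s by (auto simp: abs_le_iff) (metis minus_le_iff)
    then show thesis
      using that compact_Icc[of "-S" S] unfolding compact_def o_def by blast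
  qed
  obtain v r2 where v: "continuous_on {a..b} v" and r2: "strict_mono (r2 :: nat \<Rightarrow> nat)"
    and uni: "\<And>e. 0 < e \<Longrightarrow> \<exists>N. \<forall>n x. n \<ge> N \<and> x \<in> {a..b} \<longrightarrow> norm (u (r1 (r2 n)) x - v x) < e"
  proof (rule Arzela_Ascoli[of "{a..b}" "\<lambda>n. u (r1 n)" "?L * (b - a)"])
    show "norm (u (r1 n) x) \<le> ?L * (b - a)" if x: "x \<in> {a..b}" for n x
    proof -
      have "u (r1 n) a = 0" using u[of a] ab by simp
      then have "\<bar>u (r1 n) x\<bar> \<le> ?L * \<bar>x - a\<bar>" using lip[of x a "r1 n"] x ab by auto
      also have "\<dots> \<le> ?L * (b - a)" using x L0 by (intro mult_left_mono) auto
      finally show ?thesis by simp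
    qed
    show "\<exists>d>0. \<forall>n y. y \<in> {a..b} \<and> norm (x - y) < d \<longrightarrow> norm (u (r1 n) x - u (r1 n) y) < e"
      if x: "x \<in> {a..b}" and e: "0 < e" for x e
    proof (intro exI[of _ "e / (?L + 1)"] conjI allI impI)
      show "0 < e / (?L + 1)" using e L1 by (rule divide_pos_pos)
      fix n y assume y: "y \<in> {a..b} \<and> norm (x - y) < e / (?L + 1)"
      have "\<bar>u (r1 n) x - u (r1 n) y\<bar> \<le> ?L * \<bar>x - y\<bar>" using lip x y by auto
      also have "\<dots> \<le> (?L + 1) * \<bar>x - y\<bar>" by (intro mult_right_mono) auto
      also have "\<dots> < e" using y L1 by (simp add: pos_less_divide_eq mult.commute)
      finally show "norm (u (r1 n) x - u (r1 n) y) < e" by simp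
    qed
  qed auto
  define r where "r n = r1 (r2 n)" for n
  have r: "strict_mono r" using r1(1) r2 by (simp add: r_def strict_mono_def)
  have sr: "(\<lambda>n. \<sigma> (r n)) \<longlonglongrightarrow> s'"
    using LIMSEQ_subseq_LIMSEQ[OF r1(2) r2] by (simp add: r_def o_def)
  have dr: "(\<lambda>n. \<delta> (r n)) \<longlonglongrightarrow> 0"
    using LIMSEQ_subseq_LIMSEQ[OF d(2) r] by (simp add: o_def)
  have ulim: "(\<lambda>n. u (r n) x) \<longlonglongrightarrow> v x" if x: "x \<in> {a..b}" for x
    unfolding LIMSEQ_iff r_def by (metis uni x)
  have shifted: "(\<lambda>n. u (r n) (max a (t - \<delta> (r n)))) \<longlonglongrightarrow> v t" if t: "t \<in> {a..b}" for t
  proof -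
    have in_ab: "max a (t - \<delta> (r n)) \<in> {a..b}" for n using t d(1)[of "r n"] by auto
    have "(\<lambda>n. u (r n) (max a (t - \<delta> (r n))) - u (r n) t) \<longlonglongrightarrow> 0"
    proof (rule Lim_null_comparison)
      show "\<forall>\<^sub>F n in sequentially. norm (u (r n) (max a (t - \<delta> (r n))) - u (r n) t) \<le> ?L * \<delta> (r n)"
      proof (intro always_eventually allI)
        fix n
        have "\<bar>u (r n) (max a (t - \<delta> (r n))) - u (r n) t\<bar> \<le> ?L * \<bar>max a (t - \<delta> (r n)) - t\<bar>"
          using lip in_ab t by auto
        also have "\<dots> \<le> ?L * \<delta> (r n)" using t d(1)[of "r n"] L0 by (intro mult_left_mono) auto
        finally show "norm (u (r n) (max a (t - \<delta> (r n))) - u (r n) t) \<le> ?L * \<delta> (r n)" by simp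
      qed
      show "(\<lambda>n. ?L * \<delta> (r n)) \<longlonglongrightarrow> 0" using tendsto_mult_left[OF dr, of ?L] by simp
    qed
    from tendsto_add[OF this ulim[OF t]] show ?thesis by simp
  qed
  have "v x = profile s' (\<lambda>t. F t (v t)) x" if x: "x \<in> {a..b}" for x
  proof (rule LIMSEQ_unique[OF ulim[OF x]])
    have "(\<lambda>n. profile (\<sigma> (r n)) (?h (r n)) x) \<longlonglongrightarrow> profile s' (\<lambda>t. F t (v t)) x"
    proof (rule profile_tendsto[OF K hint _ _ sr x])
      show "0 \<le> ?h (r n) t \<and> ?h (r n) t \<le> K t" if "t \<in> {a..b}" for n t using hb[OF that] .
      show "(\<lambda>n. ?h (r n) t) \<longlonglongrightarrow> F t (v t)" if "t \<in> {a..b}" for t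
        using F that by (intro continuous_on_tendsto_compose[of UNIV "F t", OF _ shifted[OF that]])
          (auto simp: caratheodory_def)
    qed
    then show "(\<lambda>n. u (r n) x) \<longlonglongrightarrow> profile s' (\<lambda>t. F t (v t)) x"
      using u[OF x] by simp
  qed
  then have "ivp F s' v" using v by (simp add: ivp_def)
  moreover have "(\<lambda>n. u (r n) b) \<longlonglongrightarrow> v b" using ulim ab by simp
  ultimately show thesis using that r sr by blast
qed

text \<open>
  For small delay the end value is positive at \<open>s1\<close> and negative at \<open>s2\<close>: otherwise delayed solutions
  with the wrong sign would accumulate at a solution of the undelayed problem that violates one of
  the two hypotheses. The end value of the delayed solution is continuous in \<open>s\<close>, so it vanishes
  somewhere in between, and one more passage to the limit gives the claim. No order between \<open>s1\<close> and
  \<open>s2\<close> is imposed, as both occur.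
\<close>

lemma shooting:
  assumes F: "caratheodory F K"
    and pos: "\<And>u. ivp F s1 u \<Longrightarrow> 0 < u b" and neg: "\<And>u. ivp F s2 u \<Longrightarrow> u b < 0"
  obtains s u where "min s1 s2 \<le> s" "s \<le> max s1 s2" "ivp F s u" "u b = 0"
proof -
  \<comment> \<open>with this delay, \<open>Suc n\<close> steps reach \<open>b\<close> exactly\<close>
  define \<delta> where "\<delta> n = (b - a) / real (Suc n)" for n
  define U where "U n s = delayed F (\<delta> n) s (Suc n)" for n s
  have d0: "0 < \<delta> n" for n using ab by (simp add: \<delta>_def)
  have dlim: "\<delta> \<longlonglongrightarrow> 0"
    unfolding \<delta>_def[abs_def] using tendsto_mult_left[OF LIMSEQ_inverse_real_of_nat, of "b - a"]
    by (simp add: divide_inverse)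
  have Uc: "continuous_on {a..b} (U n s)" for n s
    unfolding U_def using d0[of n] by (intro continuous_delayed[OF F]) auto
  have Ueq: "U n s x = profile s (\<lambda>t. F t (U n s (max a (t - \<delta> n)))) x" if "x \<in> {a..b}" for n s x
  proof -
    have "real (Suc n) * \<delta> n = b - a" by (simp add: \<delta>_def)
    then have "x \<le> a + real (Suc n) * \<delta> n" using that by simp
    from delayed_stable[OF d0 that this, of F s] show ?thesis
      unfolding U_def by (subst delayed.simps(2)[symmetric]) simp
  qed
  have limit: "\<exists>r' s' v. strict_mono (r' :: nat \<Rightarrow> nat) \<and> (\<lambda>n. \<sigma> (r' n)) \<longlonglongrightarrow> s' \<and>
      (\<lambda>n. U (r (r' n)) (\<sigma> (r' n)) b) \<longlonglongrightarrow> v b \<and> ivp F s' v"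
    if r: "strict_mono (r :: nat \<Rightarrow> nat)" and \<sigma>: "\<And>n. \<bar>\<sigma> n\<bar> \<le> S" for r \<sigma> S
  proof -
    have dr: "(\<lambda>n. \<delta> (r n)) \<longlonglongrightarrow> 0" using LIMSEQ_subseq_LIMSEQ[OF dlim r] by (simp add: o_def)
    have dr0: "0 \<le> \<delta> (r n)" for n using d0[of "r n"] by simp
    have uc: "continuous_on {a..b} (U (r n) (\<sigma> n))" for n by (rule Uc)
    have ue: "U (r n) (\<sigma> n) x = profile (\<sigma> n) (\<lambda>t. F t (U (r n) (\<sigma> n) (max a (t - \<delta> (r n))))) x"
      if "x \<in> {a..b}" for n x by (rule Ueq[OF that])
    obtain r' s' v where "strict_mono (r' :: nat \<Rightarrow> nat)" "(\<lambda>n. \<sigma> (r' n)) \<longlonglongrightarrow> s'"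
      "(\<lambda>n. U (r (r' n)) (\<sigma> (r' n)) b) \<longlonglongrightarrow> v b" "ivp F s' v"
      using delayed_limit_is_ivp[OF F \<sigma> dr0 dr uc ue] by blast
    then show ?thesis by blast
  qed
  have "\<forall>\<^sub>F n in sequentially. 0 < U n s1 b"
  proof (rule ccontr)
    assume "\<not> ?thesis"
    then obtain r where r: "strict_mono (r :: nat \<Rightarrow> nat)" "\<And>n. U (r n) s1 b \<le> 0"
      using not_eventually_sequentiallyD by (metis not_le)
    obtain r' s' v where l: "strict_mono (r' :: nat \<Rightarrow> nat)" "(\<lambda>n::nat. s1) \<longlonglongrightarrow> s'"
      "(\<lambda>n. U (r (r' n)) s1 b) \<longlonglongrightarrow> v b" "ivp F s' v"
      using limit[OF r(1), of "\<lambda>_. s1" "\<bar>s1\<bar>"] by auto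
    have "s' = s1" using LIMSEQ_unique[OF l(2) tendsto_const] by simp
    moreover have "v b \<le> 0" by (rule LIMSEQ_le_const2[OF l(3)]) (use r(2) in auto)
    ultimately show False using pos l(4) by force
  qed
  moreover have "\<forall>\<^sub>F n in sequentially. U n s2 b < 0"
  proof (rule ccontr)
    assume "\<not> ?thesis"
    then obtain r where r: "strict_mono (r :: nat \<Rightarrow> nat)" "\<And>n. 0 \<le> U (r n) s2 b"
      using not_eventually_sequentiallyD by (metis not_le)
    obtain r' s' v where l: "strict_mono (r' :: nat \<Rightarrow> nat)" "(\<lambda>n::nat. s2) \<longlonglongrightarrow> s'"
      "(\<lambda>n. U (r (r' n)) s2 b) \<longlonglongrightarrow> v b" "ivp F s' v"
      using limit[OF r(1), of "\<lambda>_. s2" "\<bar>s2\<bar>"] by auto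
    have "s' = s2" using LIMSEQ_unique[OF l(2) tendsto_const] by simp
    moreover have "0 \<le> v b" by (rule LIMSEQ_le_const[OF l(3)]) (use r(2) in auto)
    ultimately show False using neg l(4) by force
  qed
  ultimately have "\<forall>\<^sub>F n in sequentially. 0 < U n s1 b \<and> U n s2 b < 0" by (rule eventually_conj)
  then obtain N where N: "\<And>n. n \<ge> N \<Longrightarrow> 0 < U n s1 b \<and> U n s2 b < 0"
    by (auto simp: eventually_sequentially)
  have "\<exists>s. min s1 s2 \<le> s \<and> s \<le> max s1 s2 \<and> U (n + N) s b = 0" for n
  proof -
    have c: "continuous_on S (\<lambda>s. U (n + N) s b)" for S
    proof (rule continuous_on_sequentiallyI)
      fix \<sigma> :: "nat \<Rightarrow> real" and s assume "\<sigma> \<longlonglongrightarrow> s"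
      then show "(\<lambda>j. U (n + N) (\<sigma> j) b) \<longlonglongrightarrow> U (n + N) s b"
        unfolding U_def using d0[of "n + N"] ab by (intro delayed_tendsto[OF F]) auto
    qed
    have sgn: "0 < U (n + N) s1 b" "U (n + N) s2 b < 0" using N[of "n + N"] by auto
    show ?thesis
    proof (cases "s1 \<le> s2")
      case True
      then show ?thesis using IVT2'[of "\<lambda>s. U (n + N) s b" s2 0 s1] c sgn by force
    next
      case False
      then show ?thesis using IVT'[of "\<lambda>s. U (n + N) s b" s2 0 s1] c sgn by force
    qed
  qed
  then obtain \<sigma> where \<sigma>: "\<And>n. min s1 s2 \<le> \<sigma> n" "\<And>n. \<sigma> n \<le> max s1 s2" "\<And>n. U (n + N) (\<sigma> n) b = 0"
    by metis
  have "strict_mono (\<lambda>n. n + N)" by (simp add: strict_mono_def)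
  moreover have "\<bar>\<sigma> n\<bar> \<le> \<bar>s1\<bar> + \<bar>s2\<bar>" for n using \<sigma>(1)[of n] \<sigma>(2)[of n] by linarith
  ultimately obtain r' s' v where l: "strict_mono (r' :: nat \<Rightarrow> nat)" "(\<lambda>n. \<sigma> (r' n)) \<longlonglongrightarrow> s'"
      "(\<lambda>n. U (r' n + N) (\<sigma> (r' n)) b) \<longlonglongrightarrow> v b" "ivp F s' v"
    using limit[of "\<lambda>n. n + N" \<sigma> "\<bar>s1\<bar> + \<bar>s2\<bar>"] by blast
  have "min s1 s2 \<le> s'" by (rule LIMSEQ_le_const[OF l(2)]) (use \<sigma>(1) in auto)
  moreover have "s' \<le> max s1 s2" by (rule LIMSEQ_le_const2[OF l(2)]) (use \<sigma>(2) in auto)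
  moreover have "v b = 0" using l(3) \<sigma>(3) by (simp add: LIMSEQ_const_iff)
  ultimately show thesis using that l(4) by blast
qed

end

section \<open>Solutions as fixed profiles\<close>

locale dirichlet_problem = phi_laplacian +
  fixes f g m n :: "real \<Rightarrow> real"
  assumes f_cont: "continuous_on {0..} f" and f_nonneg: "\<And>t. 0 \<le> t \<Longrightarrow> 0 \<le> f t"
    and g_cont: "continuous_on {0..} g" and g_nonneg: "\<And>t. 0 \<le> t \<Longrightarrow> 0 \<le> g t"
    and m_L1: "integrable (lebesgue_on {a<..<b}) m"
    and m_nonneg: "AE x in lebesgue_on {a<..<b}. 0 \<le> m x"
    and n_L1: "integrable (lebesgue_on {a<..<b}) n"
    and n_nonneg: "AE x in lebesgue_on {a<..<b}. 0 \<le> n x"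
begin

text \<open>
  The weights are nonnegative only almost everywhere. Their positive parts allow pointwise estimates
  and have the same integrals.
\<close>

definition pos_part :: "(real \<Rightarrow> real) \<Rightarrow> real \<Rightarrow> real" where
  "pos_part k x = max 0 (k x)"

definition rhs :: "real \<Rightarrow> real \<Rightarrow> (real \<Rightarrow> real) \<Rightarrow> real \<Rightarrow> real" where
  "rhs lam mu u x = lam * pos_part m x * f (u x) + mu * pos_part n x * g (u x)"

lemma pos_part_nonneg [simp]: "0 \<le> pos_part k x"
  by (simp add: pos_part_def)

lemma pos_part_absolutely_integrable:
  assumes "integrable (lebesgue_on {a<..<b}) k"
  shows "pos_part k absolutely_integrable_on {a..b}"
proof -
  have "integrable (lebesgue_on {a<..<b}) (pos_part k)"
    unfolding pos_part_def[abs_def] using assms by simp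
  then have "pos_part k absolutely_integrable_on {a<..<b}"
    unfolding set_integrable_def by (subst (asm) integrable_restrict_space) auto
  then show ?thesis by (simp add: absolutely_integrable_on_Icc_iff_Ioo)
qed

lemma pos_part_integrable:
  "integrable (lebesgue_on {a<..<b}) k \<Longrightarrow> pos_part k integrable_on {a..b}"
  by (intro set_lebesgue_integral_eq_integral(1) pos_part_absolutely_integrable)

lemma pos_part_mult_integrable:
  assumes k: "integrable (lebesgue_on {a<..<b}) k" and q: "continuous_on {a..b} q"
  shows "(\<lambda>x. pos_part k x * q x) integrable_on {a..b}"
proof -
  have "(\<lambda>x. q x * pos_part k x) absolutely_integrable_on {a..b}"
  proof (rule absolutely_integrable_bounded_measurable_product_real)
    show "q \<in> borel_measurable (lebesgue_on {a..b})"
      by (intro continuous_imp_measurable_on_sets_lebesgue q) simp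
    show "bounded (q ` {a..b})"
      by (intro compact_imp_bounded compact_continuous_image q) simp
  qed (use pos_part_absolutely_integrable[OF k] in auto)
  then show ?thesis
    by (simp add: mult.commute set_lebesgue_integral_eq_integral(1))
qed

text \<open>
  The mass of the weight on \<open>{a + d..b - d}\<close> depends continuously on \<open>d\<close> and is positive for \<open>d = 0\<close>.
\<close>

lemma pos_part_integral_inner_pos:
  assumes k: "integrable (lebesgue_on {a<..<b}) k" and nonneg: "AE x in lebesgue_on {a<..<b}. 0 \<le> k x"
    and nz: "\<not> (AE x in lebesgue_on {a<..<b}. k x = 0)"
  obtains d where "0 < d" "2 * d < b - a" "0 < integral {a + d..b - d} (pos_part k)"
proof -
  have pi: "pos_part k integrable_on {a..b}" by (rule pos_part_integrable[OF k])
  have pos: "0 < integral {a..b} (pos_part k)"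
  proof (rule ccontr)
    assume "\<not> ?thesis"
    then have "integral {a..b} (pos_part k) = 0"
      using integral_nonneg[OF pi] by force
    then have "integral {a<..<b} (pos_part k) = 0" by (simp add: integral_open_interval_real)
    moreover have il: "integrable (lebesgue_on {a<..<b}) (pos_part k)"
      unfolding pos_part_def[abs_def] using k by simp
    ultimately have "integral\<^sup>L (lebesgue_on {a<..<b}) (pos_part k) = 0"
      by (simp add: lebesgue_integral_eq_integral)
    then have "AE x in lebesgue_on {a<..<b}. pos_part k x = 0"
      by (subst (asm) integral_nonneg_eq_0_iff_AE[OF il]) auto
    with nonneg have "AE x in lebesgue_on {a<..<b}. k x = 0"
      by eventually_elim (auto simp: pos_part_def max_def)
    with nz show False by simp
  qed
  define M where "M x = integral {a..x} (pos_part k)" for x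
  have Mc: "continuous_on {a..b} M" unfolding M_def[abs_def] by (intro indefinite_integral_continuous_1 pi)
  define d where "d j = (b - a) / (real j + 3)" for j
  have "(\<lambda>j. (b - a) * inverse (real (Suc (j + 2)))) \<longlonglongrightarrow> (b - a) * 0"
    by (intro tendsto_mult_left LIMSEQ_ignore_initial_segment[OF LIMSEQ_inverse_real_of_nat])
  then have dl: "d \<longlonglongrightarrow> 0" by (simp add: d_def[abs_def] divide_inverse add.commute)
  have d0: "0 < d j" "2 * d j < b - a" for j
  proof -
    show "0 < d j" using ab by (simp add: d_def)
    have "d j \<le> (b - a) / 3" unfolding d_def using ab by (intro divide_left_mono) auto
    then show "2 * d j < b - a" using ab by simp
  qed
  have d_in: "a + d j \<in> {a..b}" "b - d j \<in> {a..b}" for j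
    using d0[of j] by auto
  have "(\<lambda>j. M (a + d j)) \<longlonglongrightarrow> M (a + 0)"
    using d_in ab by (intro continuous_on_tendsto_compose[OF Mc] tendsto_add tendsto_const dl always_eventually) auto
  moreover have "(\<lambda>j. M (b - d j)) \<longlonglongrightarrow> M (b - 0)"
    using d_in ab by (intro continuous_on_tendsto_compose[OF Mc] tendsto_diff tendsto_const dl always_eventually) auto
  ultimately have "(\<lambda>j. M (b - d j) - M (a + d j)) \<longlonglongrightarrow> M (b - 0) - M (a + 0)" by (intro tendsto_diff)
  moreover have "0 < M (b - 0) - M (a + 0)" using pos by (simp add: M_def)
  ultimately obtain j where j: "0 < M (b - d j) - M (a + d j)"
    using order_tendstoD(1) eventually_happens trivial_limit_sequentially by blast
  have "M (a + d j) + integral {a + d j..b - d j} (pos_part k) = M (b - d j)"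
    unfolding M_def using d0[of j] by (intro Henstock_Kurzweil_Integration.integral_combine integrable_on_subinterval[OF pi]) auto
  with j show thesis using that[of "d j"] d0 by auto
qed

lemma rhs_integrable:
  assumes u: "continuous_on {a..b} u" "\<And>x. x \<in> {a..b} \<Longrightarrow> 0 \<le> u x"
  shows "rhs lam mu u integrable_on {a..b}"
proof -
  have "continuous_on {a..b} (\<lambda>x. f (u x))" "continuous_on {a..b} (\<lambda>x. g (u x))"
    using u by (auto intro!: continuous_on_compose2[OF f_cont u(1)] continuous_on_compose2[OF g_cont u(1)])
  then have "(\<lambda>x. lam * (pos_part m x * f (u x)) + mu * (pos_part n x * g (u x))) integrable_on {a..b}"
    by (intro Henstock_Kurzweil_Integration.integrable_add integrable_on_mult_right pos_part_mult_integrable m_L1 n_L1)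
  then show ?thesis unfolding rhs_def[abs_def] by (simp add: mult.assoc)
qed

lemma rhs_nonneg: "0 \<le> lam \<Longrightarrow> 0 \<le> mu \<Longrightarrow> 0 \<le> u x \<Longrightarrow> 0 \<le> rhs lam mu u x"
  by (simp add: rhs_def f_nonneg g_nonneg)

lemma pos_part_eq_AE:
  "\<exists>E. negligible E \<and> (\<forall>x\<in>{a<..<b} - E. pos_part m x = m x \<and> pos_part n x = n x)"
proof -
  have "AE x in lebesgue_on {a<..<b}. pos_part m x = m x \<and> pos_part n x = n x"
    using m_nonneg n_nonneg by eventually_elim (simp add: pos_part_def)
  then show ?thesis by (rule AE_lebesgue_on_Ioo_iff[THEN iffD1])
qed

text \<open>
  Positivity in the interior and the strict signs of the end point slopes come from concavity and one
  point where \<open>u\<close> is positive. The equation holds where the flux is differentiable, hence almost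
  everywhere.
\<close>

lemma solution_of_profile:
  assumes lam: "0 \<le> lam" and mu: "0 \<le> mu"
    and nonneg: "\<And>x. x \<in> {a..b} \<Longrightarrow> 0 \<le> u x" and cont: "continuous_on {a..b} u"
    and u: "\<And>x. x \<in> {a..b} \<Longrightarrow> u x = profile s (rhs lam mu u) x"
    and end0: "u b = 0" and z: "z \<in> {a..b}" "0 < u z"
  shows "solution a b \<phi> f g m n lam mu u"
proof -
  let ?h = "rhs lam mu u"
  have h: "?h integrable_on {a..b}" by (intro rhs_integrable cont nonneg)
  have h0: "0 \<le> ?h x" if "x \<in> {a..b}" for x by (intro rhs_nonneg lam mu nonneg that)
  have deriv: "(u has_real_derivative psi (flux s ?h x)) (at x within {a..b})" if "x \<in> {a..b}" for x
    unfolding has_field_derivative_def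
    by (rule has_derivative_transform[OF that u profile_has_derivative[OF h that, unfolded has_field_derivative_def]])
  then have vd: "(u has_vector_derivative psi (flux s ?h x)) (at x within {a..b})" if "x \<in> {a..b}" for x
    using that by (simp add: has_real_derivative_iff_has_vector_derivative)
  have id: "ideriv a b u x = psi (flux s ?h x)" if "x \<in> {a..b}" for x
    unfolding ideriv_def by (rule vector_derivative_within_closed_interval[OF ab that vd[OF that]])
  have c: "continuous_on {a..b} (\<lambda>x. psi (flux s ?h x))"
    using continuous_on_compose2[OF continuous_psi continuous_flux[OF h]] by auto
  have ua: "u a = 0" using u[of a] ab by simp
  have ubz: "profile s ?h b = 0" "profile s ?h z = u z" using u[of b] u[of z] z ab end0 by auto
  have zab: "a < z" "z < b" using z ua end0 by (auto simp: less_le)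
  have "u z \<le> (z - a) * psi (flux s ?h a)"
    using profile_le_tangent[OF h h0, of a z s] z ab ubz by simp
  then have da: "0 < psi (flux s ?h a)" using zab z by (smt (verit) mult_nonneg_nonpos)
  have "u z \<le> (z - b) * psi (flux s ?h b)"
    using profile_le_tangent[OF h h0, of b z s] z ab ubz by simp
  then have db: "psi (flux s ?h b) < 0" using zab z by (smt (verit) mult_nonpos_nonneg)
  have pos: "0 < u x" if x: "x \<in> {a<..<b}" for x
  proof -
    have "profile s ?h z * bdist x \<le> (b - a) * profile s ?h x"
      using x z ubz by (intro profile_ge_bdist[OF h h0]) auto
    moreover have "0 < profile s ?h z * bdist x" using x ubz z by (simp add: bdist_def)
    ultimately have "0 < (b - a) * profile s ?h x" by linarith
    then show ?thesis using ab u[of x] x by (simp add: zero_less_mult_iff)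
  qed
  have "u differentiable_on {a..b}"
    unfolding differentiable_on_def using vd differentiableI has_vector_derivative_def by blast
  moreover have "continuous_on {a..b} (ideriv a b u)"
    by (rule continuous_on_eq[OF c]) (simp add: id)
  moreover have "0 < ideriv a b u a" "ideriv a b u b < 0"
    using da db id ab by auto
  ultimately have cone: "u \<in> pos_cone_interior a b"
    using pos ua end0 by (simp add: pos_cone_interior_def C1_zero_def)
  have phid: "\<phi> (ideriv a b u x) = flux s ?h x" if "x \<in> {a..b}" for x using id[OF that] by simp
  have ac: "abs_continuous_on_interval a b (\<lambda>x. \<phi> (ideriv a b u x))"
    by (rule abs_continuous_on_interval_transfer[OF abs_continuous_indefinite_integral[OF h h0]])
      (simp_all add: phid flux_def abs_minus_commute)
  obtain E where E: "negligible E"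
    "\<And>x. x \<in> {a<..<b} - E \<Longrightarrow> ((\<lambda>y. integral {a..y} ?h) has_real_derivative ?h x) (at x)"
    using ae_has_derivative_indefinite_integral[OF h] by blast
  obtain E' where E': "negligible E'" "\<And>x. x \<in> {a<..<b} - E' \<Longrightarrow> pos_part m x = m x \<and> pos_part n x = n x"
    using pos_part_eq_AE by blast
  have "((\<lambda>y. \<phi> (ideriv a b u y)) has_real_derivative
           - (lam * m x * f (u x) + mu * n x * g (u x))) (at x)" if x: "x \<in> {a<..<b} - (E \<union> E')" for x
  proof -
    have "(flux s ?h has_real_derivative - ?h x) (at x)"
      unfolding flux_def[abs_def] using DERIV_diff[OF DERIV_const E(2)[of x], of s] x by simp
    moreover have "?h x = lam * m x * f (u x) + mu * n x * g (u x)" using E'(2)[of x] x by (simp add: rhs_def)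
    ultimately have "(flux s ?h has_real_derivative - (lam * m x * f (u x) + mu * n x * g (u x))) (at x)" by simp
    then show ?thesis
      by (rule has_field_derivative_transform_within_open[of _ _ _ "{a<..<b}"]) (use x phid in auto)
  qed
  moreover have "negligible (E \<union> E')" using E E' by simp
  ultimately have "AE x in lebesgue_on {a<..<b}. ((\<lambda>y. \<phi> (ideriv a b u y)) has_real_derivative
           - (lam * m x * f (u x) + mu * n x * g (u x))) (at x)"
    by (intro AE_lebesgue_on_Ioo_iff[THEN iffD2] exI[of _ "E \<union> E'"]) blast
  then show ?thesis using cone ac by (simp add: solution_def)
qed

text \<open>
  Absolute continuity makes \<open>\<phi> (u')\<close> the integral of its derivative, so it is the flux that belongs to
  the initial value \<open>\<phi> (u' a)\<close>; a second integration recovers \<open>u\<close>.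
\<close>

lemma profile_of_solution:
  assumes sol: "solution a b \<phi> f g m n lam mu u"
  obtains s where "continuous_on {a..b} u" "\<And>x. x \<in> {a..b} \<Longrightarrow> 0 \<le> u x" "u b = 0"
    "\<And>x. x \<in> {a..b} \<Longrightarrow> u x = profile s (rhs lam mu u) x"
proof -
  let ?h = "rhs lam mu u" and ?G = "\<lambda>x. \<phi> (ideriv a b u x)"
  have cone: "u differentiable_on {a..b}" "continuous_on {a..b} (ideriv a b u)" "u a = 0" "u b = 0"
    "\<And>x. x \<in> {a<..<b} \<Longrightarrow> 0 < u x"
    and ac: "abs_continuous_on_interval a b ?G"
    and ae: "AE x in lebesgue_on {a<..<b}. (?G has_real_derivative
           - (lam * m x * f (u x) + mu * n x * g (u x))) (at x)"
    using sol by (auto simp: solution_def pos_cone_interior_def C1_zero_def)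
  have cont: "continuous_on {a..b} u" using cone(1) by (rule differentiable_imp_continuous_on)
  have nonneg: "0 \<le> u x" if "x \<in> {a..b}" for x
    using cone(3,4) cone(5)[of x] that by (cases "x = a \<or> x = b") (auto simp: less_le)
  have h: "?h integrable_on {a..b}" by (intro rhs_integrable cont nonneg)
  obtain E where E: "negligible E" "\<And>x. x \<in> {a<..<b} - E \<Longrightarrow> (?G has_real_derivative
           - (lam * m x * f (u x) + mu * n x * g (u x))) (at x)"
    using AE_lebesgue_on_Ioo_iff[THEN iffD1, OF ae] by blast
  obtain E' where E': "negligible E'" "\<And>x. x \<in> {a<..<b} - E' \<Longrightarrow> pos_part m x = m x \<and> pos_part n x = n x"
    using pos_part_eq_AE by blast
  define Z where "Z = E \<union> E' \<union> {a, b}"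
  have Z: "negligible Z" using E E' by (simp add: Z_def)
  have G: "?G x = flux (?G a) ?h x" if x: "x \<in> {a..b}" for x
  proof -
    have d: "(?G has_real_derivative - ?h t) (at t within {a..x})" if t: "t \<in> {a..x} - Z" for t
    proof -
      have 1: "t \<in> {a<..<b} - E" using x t by (auto simp: Z_def)
      have 2: "t \<in> {a<..<b} - E'" using x t by (auto simp: Z_def)
      have "- (lam * m t * f (u t) + mu * n t * g (u t)) = - ?h t"
        using E'(2)[OF 2] by (simp add: rhs_def)
      then have "(?G has_real_derivative - ?h t) (at t)"
        using E(2)[OF 1] by (simp only:)
      then show ?thesis by (rule has_field_derivative_at_within)
    qed
    have ax: "a \<le> x" "x \<le> b" using x by auto
    have "((\<lambda>t. - ?h t) has_integral (?G x - ?G a)) {a..x}"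
      by (rule has_integral_derivative_of_abs_continuous[where G = ?G,
            OF ax(1) abs_continuous_on_interval_subset[OF ac ax(2)] Z d])
    then have "(?h has_integral (?G a - ?G x)) {a..x}"
      using has_integral_neg[of "\<lambda>t. - ?h t" "?G x - ?G a" "{a..x}"] by simp
    then have "integral {a..x} ?h = ?G a - ?G x" by (rule integral_unique)
    then show ?thesis by (simp add: flux_def)
  qed
  have "u x = profile (?G a) ?h x" if x: "x \<in> {a..b}" for x
  proof -
    have vd: "(u has_vector_derivative ideriv a b u t) (at t within {a..b})" if "t \<in> {a..b}" for t
      using cone(1) that unfolding ideriv_def differentiable_on_def by (simp add: vector_derivative_works)
    have "(ideriv a b u has_integral (u x - u a)) {a..x}"
      using x by (intro fundamental_theorem_of_calculus has_vector_derivative_within_subset[OF vd]) auto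
    then have "u x = integral {a..x} (ideriv a b u)" using cone(3) by (simp add: integral_unique)
    also have "\<dots> = profile (?G a) ?h x"
      unfolding profile_def
    proof (rule Henstock_Kurzweil_Integration.integral_cong)
      fix t assume "t \<in> {a..x}"
      then have "?G t = flux (?G a) ?h t" using G[of t] x by auto
      then show "ideriv a b u t = psi (flux (?G a) ?h t)" by (metis psi_phi)
    qed
    finally show ?thesis .
  qed
  then show thesis using that[OF cont nonneg cone(4)] by blast
qed

section \<open>Truncated reaction terms\<close>

abbreviation clip :: "real \<Rightarrow> real \<Rightarrow> real \<Rightarrow> real" where
  "clip l r y \<equiv> max l (min y r)"

definition clipped_rhs :: "real \<Rightarrow> real \<Rightarrow> (real \<Rightarrow> real) \<Rightarrow> (real \<Rightarrow> real) \<Rightarrow> real \<Rightarrow> real \<Rightarrow> real" where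
  "clipped_rhs lam mu lo hi x y = rhs lam mu (\<lambda>t. clip (lo t) (hi t) y) x"

lemma clipped_rhs_along:
  "clipped_rhs lam mu lo hi x (u x) = rhs lam mu (\<lambda>t. clip (lo t) (hi t) (u t)) x"
  by (simp add: clipped_rhs_def rhs_def)

lemma reaction_bound:
  fixes k :: "real \<Rightarrow> real" and M :: real
  assumes "continuous_on {0..} k"
  obtains C where "0 \<le> C" "\<And>t. 0 \<le> t \<Longrightarrow> t \<le> M \<Longrightarrow> k t \<le> C"
proof -
  have "compact (k ` {0..M})"
    by (intro compact_continuous_image continuous_on_subset[OF assms]) auto
  then obtain B where "\<And>t. t \<in> {0..M} \<Longrightarrow> norm (k t) \<le> B"
    using compact_imp_bounded bounded_iff by (metis imageI)
  then show thesis using that[of "max 0 B"] by (force simp: abs_le_iff)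
qed

lemma rhs_le:
  assumes "0 \<le> lam" "0 \<le> mu" and "f (u x) \<le> Cf" "g (u x) \<le> Cg"
  shows "rhs lam mu u x \<le> lam * Cf * pos_part m x + mu * Cg * pos_part n x"
proof -
  have "lam * pos_part m x * f (u x) \<le> lam * pos_part m x * Cf"
    "mu * pos_part n x * g (u x) \<le> mu * pos_part n x * Cg"
    using assms by (intro mult_left_mono; simp)+
  then show ?thesis by (simp add: rhs_def mult.assoc mult.commute mult.left_commute)
qed

lemma has_integral_weights:
  "((\<lambda>x. A * pos_part m x + B * pos_part n x) has_integral
     A * integral {a..b} (pos_part m) + B * integral {a..b} (pos_part n)) {a..b}"
  by (intro has_integral_add has_integral_mult_right integrable_integral pos_part_integrable m_L1 n_L1)

lemma integral_rhs_le:
  assumes nn: "0 \<le> lam" "0 \<le> mu" and u: "continuous_on {a..b} u" "\<And>x. x \<in> {a..b} \<Longrightarrow> 0 \<le> u x"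
    and bounds: "\<And>x. x \<in> {a..b} \<Longrightarrow> f (u x) \<le> Cf" "\<And>x. x \<in> {a..b} \<Longrightarrow> g (u x) \<le> Cg"
  shows "integral {a..b} (rhs lam mu u)
    \<le> lam * Cf * integral {a..b} (pos_part m) + mu * Cg * integral {a..b} (pos_part n)"
proof (rule has_integral_le)
  show "(rhs lam mu u has_integral integral {a..b} (rhs lam mu u)) {a..b}"
    by (intro integrable_integral rhs_integrable u)
  show "rhs lam mu u x \<le> lam * Cf * pos_part m x + mu * Cg * pos_part n x" if "x \<in> {a..b}" for x
    by (intro rhs_le nn bounds that)
qed (rule has_integral_weights)

lemma clipped_rhs_caratheodory:
  assumes nn: "0 \<le> lam" "0 \<le> mu"
    and lo: "continuous_on {a..b} lo" and hi: "continuous_on {a..b} hi"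
    and le: "\<And>x. x \<in> {a..b} \<Longrightarrow> 0 \<le> lo x \<and> lo x \<le> hi x"
  shows "\<exists>K. caratheodory (clipped_rhs lam mu lo hi) K"
proof -
  obtain M where M: "\<And>x. x \<in> {a..b} \<Longrightarrow> hi x \<le> M"
    using continuous_attains_sup[OF compact_Icc _ hi] ab by fastforce
  obtain Cf where Cf: "\<And>t. 0 \<le> t \<Longrightarrow> t \<le> M \<Longrightarrow> f t \<le> Cf" using reaction_bound[OF f_cont] by blast
  obtain Cg where Cg: "\<And>t. 0 \<le> t \<Longrightarrow> t \<le> M \<Longrightarrow> g t \<le> Cg" using reaction_bound[OF g_cont] by blast
  have range: "0 \<le> clip (lo x) (hi x) y" "clip (lo x) (hi x) y \<le> M" if "x \<in> {a..b}" for x y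
    using le[OF that] M[OF that] by auto
  have "caratheodory (clipped_rhs lam mu lo hi) (\<lambda>x. lam * Cf * pos_part m x + mu * Cg * pos_part n x)"
    unfolding caratheodory_def
  proof (intro conjI ballI allI impI)
    show "(\<lambda>x. lam * Cf * pos_part m x + mu * Cg * pos_part n x) integrable_on {a..b}"
      using has_integral_weights by blast
    fix x assume x: "x \<in> {a..b}"
    show "continuous_on UNIV (clipped_rhs lam mu lo hi x)"
      unfolding clipped_rhs_def rhs_def using range[OF x]
      by (intro continuous_intros continuous_on_compose2[OF f_cont] continuous_on_compose2[OF g_cont]) auto
    show "0 \<le> clipped_rhs lam mu lo hi x y" for y
      unfolding clipped_rhs_def by (intro rhs_nonneg nn range x)
    show "clipped_rhs lam mu lo hi x y \<le> lam * Cf * pos_part m x + mu * Cg * pos_part n x" for y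
      unfolding clipped_rhs_def by (intro rhs_le nn Cf Cg range x)
  next
    fix v :: "real \<Rightarrow> real" assume v: "continuous_on {a..b} v"
    have "rhs lam mu (\<lambda>t. clip (lo t) (hi t) (v t)) integrable_on {a..b}"
      by (intro rhs_integrable range continuous_intros lo hi v)
    then show "(\<lambda>x. clipped_rhs lam mu lo hi x (v x)) integrable_on {a..b}"
      by (simp add: clipped_rhs_along)
  qed
  then show ?thesis by blast
qed

text \<open>
  An initial flux above the mass of \<open>K\<close> stays positive up to \<open>b\<close>, and a negative one stays negative, so
  shooting applies between the two.
\<close>

lemma dirichlet_solvable:
  assumes F: "caratheodory F K"
  obtains s u where "ivp F s u" "u b = 0"
proof -
  have h: "(\<lambda>t. F t (u t)) integrable_on {a..b}" "\<And>t. t \<in> {a..b} \<Longrightarrow> 0 \<le> F t (u t)"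
    "integral {a..b} (\<lambda>t. F t (u t)) \<le> integral {a..b} K" if "ivp F s u" for s u
  proof -
    show hi: "(\<lambda>t. F t (u t)) integrable_on {a..b}"
      using that by (intro caratheodory_integrable[OF F]) (simp add: ivp_def)
    show "\<And>t. t \<in> {a..b} \<Longrightarrow> 0 \<le> F t (u t)" by (rule caratheodory_bounds(1)[OF F])
    show "integral {a..b} (\<lambda>t. F t (u t)) \<le> integral {a..b} K"
      using F by (intro integral_le[OF hi] caratheodory_bounds(2)[OF F]) (auto simp: caratheodory_def)
  qed
  show thesis
  proof (rule shooting[OF F, of "integral {a..b} K + 1" "-1"])
    fix u assume u: "ivp F (integral {a..b} K + 1) u"
    have "0 < (b - a) * psi (integral {a..b} K + 1 - integral {a..b} (\<lambda>t. F t (u t)))"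
      using h(3)[OF u] ab by (intro mult_pos_pos) auto
    also have "\<dots> \<le> profile (integral {a..b} K + 1) (\<lambda>t. F t (u t)) b"
      by (rule profile_end_ge[OF h(1,2)[OF u]])
    also have "\<dots> = u b" using u ab by (simp add: ivp_def)
    finally show "0 < u b" .
  next
    fix u assume u: "ivp F (-1) u"
    have "u b = profile (-1) (\<lambda>t. F t (u t)) b" using u ab by (simp add: ivp_def)
    also have "\<dots> \<le> (b - a) * psi (-1)"
      using profile_le_tangent[OF h(1,2)[OF u], of a b "-1"] ab by simp
    also have "\<dots> < 0" using ab by (simp add: mult_less_0_iff)
    finally show "u b < 0" .
  qed (use that in blast)
qed

lemma ivp_clipped:
  assumes nn: "0 \<le> lam" "0 \<le> mu" and lo: "continuous_on {a..b} lo" and hi: "continuous_on {a..b} hi"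
    and le: "\<forall>x\<in>{a..b}. 0 \<le> lo x \<and> lo x \<le> hi x"
    and u: "ivp (clipped_rhs lam mu lo hi) s u"
  shows "rhs lam mu (\<lambda>t. clip (lo t) (hi t) (u t)) integrable_on {a..b}"
    and "\<And>x. x \<in> {a..b} \<Longrightarrow> 0 \<le> rhs lam mu (\<lambda>t. clip (lo t) (hi t) (u t)) x"
    and "\<And>x. x \<in> {a..b} \<Longrightarrow> u x = profile s (rhs lam mu (\<lambda>t. clip (lo t) (hi t) (u t))) x"
    and "continuous_on {a..b} (\<lambda>t. clip (lo t) (hi t) (u t))" and "continuous_on {a..b} u"
proof -
  show uc: "continuous_on {a..b} u" using u by (simp add: ivp_def)
  show cc: "continuous_on {a..b} (\<lambda>t. clip (lo t) (hi t) (u t))" by (intro continuous_intros uc lo hi)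
  show "rhs lam mu (\<lambda>t. clip (lo t) (hi t) (u t)) integrable_on {a..b}"
    by (rule rhs_integrable[OF cc]) (use le in \<open>auto simp: le_max_iff_disj\<close>)
  show "0 \<le> rhs lam mu (\<lambda>t. clip (lo t) (hi t) (u t)) x" if "x \<in> {a..b}" for x
    using le that by (intro rhs_nonneg nn) (auto simp: le_max_iff_disj)
  show "u x = profile s (rhs lam mu (\<lambda>t. clip (lo t) (hi t) (u t))) x" if "x \<in> {a..b}" for x
    using u that by (simp add: ivp_def clipped_rhs_along)
qed

lemma solution_bounds:
  assumes "solution a b \<phi> f g m n lam mu u"
  shows "\<And>x. x \<in> {a..b} \<Longrightarrow> u x \<le> sup_norm_on a b u" "0 \<le> sup_norm_on a b u"
    "\<And>M. (\<And>x. x \<in> {a..b} \<Longrightarrow> u x \<le> M) \<Longrightarrow> sup_norm_on a b u \<le> M"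
proof -
  obtain s where u: "continuous_on {a..b} u" "\<And>x. x \<in> {a..b} \<Longrightarrow> 0 \<le> u x"
    using profile_of_solution[OF assms] by blast
  have "compact ((\<lambda>x. \<bar>u x\<bar>) ` {a..b})"
    by (intro compact_continuous_image continuous_intros u) auto
  then have bdd: "bdd_above ((\<lambda>x. \<bar>u x\<bar>) ` {a..b})"
    by (intro bounded_imp_bdd_above compact_imp_bounded)
  show le: "u x \<le> sup_norm_on a b u" if "x \<in> {a..b}" for x
    using cSUP_upper[OF that bdd] unfolding sup_norm_on_def by linarith
  show "0 \<le> sup_norm_on a b u" using le[of a] u(2)[of a] ab by force
  show "sup_norm_on a b u \<le> M" if "\<And>x. x \<in> {a..b} \<Longrightarrow> u x \<le> M" for M
    unfolding sup_norm_on_def using that u(2) ab by (intro cSUP_least) auto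
qed

text \<open>
  On \<open>{a + d..b - d}\<close> the clipped argument is at least \<open>e * d\<close>, so the source has mass at least
  \<open>J = lam * c0 * (e * d) powr q * Jm\<close> there, where \<open>Jm\<close> is the mass of \<open>m\<close> on that interval. The
  resulting lower bound for \<open>u\<close> dominates \<open>e * bdist\<close> as soon as \<open>e * (b - a) / d \<le> psi (J / 2)\<close>. In
  terms of \<open>t = e * (b - a) / d\<close> this reads \<open>\<phi> t \<le> const * t powr q\<close>, which holds for all small \<open>t\<close>.
\<close>

lemma clipped_solution_above_barrier:
  assumes lam: "0 < lam" and mu: "0 \<le> mu" and m0: "\<not> (AE x in lebesgue_on {a<..<b}. m x = 0)"
    and hi: "continuous_on {a..b} hi" and e0: "0 < e0"
    and hi_ge: "\<And>x. x \<in> {a..b} \<Longrightarrow> e0 * bdist x \<le> hi x" and hi_le: "\<And>x. x \<in> {a..b} \<Longrightarrow> hi x \<le> t0"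
    and F: "cond_F_at \<phi> f t0"
  obtains e s u where "0 < e" "e \<le> e0" "ivp (clipped_rhs lam mu (\<lambda>x. e * bdist x) hi) s u" "u b = 0"
    "\<And>x. x \<in> {a..b} \<Longrightarrow> e * bdist x \<le> u x"
proof -
  obtain c0 q where c0: "0 < c0" and q: "0 < q" and f_ge: "\<And>t. 0 \<le> t \<Longrightarrow> t \<le> t0 \<Longrightarrow> c0 * t powr q \<le> f t"
    and lim: "filterlim (\<lambda>t. t powr q / \<phi> t) at_top (at_right 0)"
    using F unfolding cond_F_at_def by auto
  obtain d where d: "0 < d" "2 * d < b - a" and Jm: "0 < integral {a + d..b - d} (pos_part m)" (is "0 < ?Jm")
    using pos_part_integral_inner_pos[OF m_L1 m_nonneg m0] by blast
  define \<kappa> where "\<kappa> = d\<^sup>2 / (b - a)"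
  have \<kappa>: "0 < \<kappa>" using d ab by (simp add: \<kappa>_def)
  \<comment> \<open>\<open>\<kappa>\<close> is the factor with \<open>e * d = \<kappa> * t\<close>, and \<open>A\<close> is chosen so that \<open>A * \<phi> t \<le> t powr q\<close> means
    \<open>\<phi> t \<le> J / 2\<close>\<close>
  define A where "A = 2 / (lam * c0 * \<kappa> powr q * ?Jm)"
  have A: "0 < A" using lam c0 \<kappa> Jm by (simp add: A_def)
  have "\<forall>\<^sub>F t in at_right 0. A \<le> t powr q / \<phi> t"
    using lim by (simp add: filterlim_at_top)
  then obtain r where r: "0 < r" "\<And>t. 0 < t \<Longrightarrow> t < r \<Longrightarrow> A \<le> t powr q / \<phi> t"
    unfolding eventually_at_right_field by blast
  define t where "t = min (r / 2) (e0 * (b - a) / d)"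
  have t: "0 < t" "t < r" "t \<le> e0 * (b - a) / d" using r e0 ab d by (auto simp: t_def)
  define e where "e = t * d / (b - a)"
  have e: "0 < e" using t d ab by (simp add: e_def)
  have ee0: "e \<le> e0" using t(3) d ab by (simp add: e_def field_simps)
  have ed: "e * d = t * \<kappa>" by (simp add: e_def \<kappa>_def power2_eq_square)
  define J where "J = lam * c0 * (e * d) powr q * ?Jm"
  have "A * \<phi> t \<le> t powr q" using r(2)[OF t(1,2)] t(1) by (simp add: pos_le_divide_eq)
  then have phit: "\<phi> t \<le> J / 2"
    unfolding J_def ed A_def using lam c0 \<kappa> Jm t by (simp add: powr_mult field_simps)
  then have psiJ: "t \<le> psi (J / 2)" by (metis psi_le_iff psi_phi)
  let ?lo = "\<lambda>x. e * bdist x"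
  have loc: "continuous_on {a..b} ?lo" unfolding bdist_def by (intro continuous_intros)
  have lo: "0 \<le> ?lo x" "?lo x \<le> hi x" if "x \<in> {a..b}" for x
  proof -
    have "0 \<le> bdist x" using that by (simp add: bdist_def)
    then show "0 \<le> ?lo x" "?lo x \<le> hi x"
      using e mult_right_mono[OF ee0, of "bdist x"] hi_ge[OF that] by auto
  qed
  obtain K where Kc: "caratheodory (clipped_rhs lam mu ?lo hi) K"
    using clipped_rhs_caratheodory[OF less_imp_le[OF lam] mu loc hi] lo by blast
  obtain s u where u: "ivp (clipped_rhs lam mu ?lo hi) s u" "u b = 0"
    using dirichlet_solvable[OF Kc] by blast
  let ?h = "\<lambda>x. clipped_rhs lam mu ?lo hi x (u x)"
  have h: "?h integrable_on {a..b}"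
    using u(1) by (intro caratheodory_integrable[OF Kc]) (simp add: ivp_def)
  have h0: "0 \<le> ?h x" if "x \<in> {a..b}" for x by (rule caratheodory_bounds(1)[OF Kc that])
  have prof: "u x = profile s ?h x" if "x \<in> {a..b}" for x using u(1) that by (simp add: ivp_def)
  have "J \<le> integral {a + d..b - d} ?h"
  proof -
    have "integral {a + d..b - d} (\<lambda>x. lam * c0 * (e * d) powr q * pos_part m x) \<le> integral {a + d..b - d} ?h"
    proof (rule integral_le)
      show "(\<lambda>x. lam * c0 * (e * d) powr q * pos_part m x) integrable_on {a + d..b - d}"
        using d by (intro integrable_on_mult_right integrable_on_subinterval[OF pos_part_integrable[OF m_L1]]) auto
      show "?h integrable_on {a + d..b - d}"
        using d by (intro integrable_on_subinterval[OF h]) auto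
      fix x assume x: "x \<in> {a + d..b - d}"
      then have xab: "x \<in> {a..b}" using d by auto
      define y where "y = clip (?lo x) (hi x) (u x)"
      have "e * d \<le> ?lo x" using x e by (simp add: bdist_def)
      then have y: "e * d \<le> y" "0 \<le> y" "y \<le> t0"
        using lo[OF xab] hi_le[OF xab] by (auto simp: y_def)
      have "c0 * (e * d) powr q \<le> c0 * y powr q"
        using c0 q y e d by (intro mult_left_mono powr_mono2) auto
      also have "\<dots> \<le> f y" by (intro f_ge y)
      finally have "lam * pos_part m x * (c0 * (e * d) powr q) \<le> lam * pos_part m x * f y"
        using lam by (intro mult_left_mono) auto
      moreover have "0 \<le> mu * pos_part n x * g y" using mu y by (simp add: g_nonneg)
      ultimately show "lam * c0 * (e * d) powr q * pos_part m x \<le> ?h x"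
        unfolding clipped_rhs_along rhs_def y_def by (simp add: mult_ac)
    qed
    then show ?thesis by (simp add: J_def)
  qed
  then have lower: "d * psi (J / 2) * bdist x \<le> (b - a) * u x" if "x \<in> {a..b}" for x
    using profile_lower_bound[OF h h0 _ d that, where s = s] u(2) prof[OF that] prof[of b] ab by simp
  have "?lo x \<le> u x" if x: "x \<in> {a..b}" for x
  proof -
    have "(b - a) * ?lo x = d * t * bdist x" using ab by (simp add: e_def)
    also have "\<dots> \<le> d * psi (J / 2) * bdist x"
      using psiJ d x by (intro mult_right_mono mult_left_mono) (auto simp: bdist_def)
    also have "\<dots> \<le> (b - a) * u x" by (rule lower[OF x])
    finally show ?thesis using ab by simp
  qed
  then show thesis using that e ee0 u by blast
qed

lemma solution_of_clipped:
  assumes nn: "0 \<le> lam" "0 \<le> mu"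
    and u: "ivp (clipped_rhs lam mu lo hi) s u" "u b = 0"
    and lo: "\<And>x. x \<in> {a..b} \<Longrightarrow> 0 \<le> lo x" "\<And>x. x \<in> {a..b} \<Longrightarrow> lo x \<le> u x"
    and hi: "\<And>x. x \<in> {a..b} \<Longrightarrow> u x \<le> hi x"
    and z: "z \<in> {a..b}" "0 < u z"
  shows "solution a b \<phi> f g m n lam mu u"
proof (rule solution_of_profile[OF nn _ _ _ u(2) z])
  show "continuous_on {a..b} u" using u(1) by (simp add: ivp_def)
  show "0 \<le> u x" if "x \<in> {a..b}" for x using lo[OF that] by simp
  fix x assume x: "x \<in> {a..b}"
  have "u x = profile s (\<lambda>t. clipped_rhs lam mu lo hi t (u t)) x" using u(1) x by (simp add: ivp_def)
  also have "\<dots> = profile s (rhs lam mu u) x"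
  proof (rule profile_cong)
    fix t assume "t \<in> {a..x}"
    then have "t \<in> {a..b}" using x by auto
    then have "clip (lo t) (hi t) (u t) = u t" using lo hi by (auto simp: max_def min_def)
    then show "clipped_rhs lam mu lo hi t (u t) = rhs lam mu u t"
      unfolding clipped_rhs_along by (simp add: rhs_def)
  qed
  finally show "u x = profile s (rhs lam mu u) x" .
qed

text \<open>
  Below height \<open>(b - a) * y\<close> the \<open>g\<close>-part of the source has mass at most a multiple of \<open>y powr r1\<close>, which
  is small compared with \<open>\<phi> y\<close> when \<open>y\<close> is small. After \<open>y\<close> is fixed, the \<open>f\<close>-part is made small by
  the choice of \<open>lam\<close>.
\<close>

lemma integral_rhs_small:
  assumes G1: "cond_G1 \<phi> g" and mu: "0 \<le> mu"
  obtains y0 where "0 < y0"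
    "\<And>y. 0 < y \<Longrightarrow> y < y0 \<Longrightarrow> \<exists>lam0>0. \<forall>lam u. 0 \<le> lam \<longrightarrow> lam < lam0 \<longrightarrow> continuous_on {a..b} u \<longrightarrow>
      (\<forall>x\<in>{a..b}. 0 \<le> u x \<and> u x \<le> (b - a) * y) \<longrightarrow> integral {a..b} (rhs lam mu u) \<le> \<phi> y / 2"
proof -
  let ?Im = "integral {a..b} (pos_part m)" and ?In = "integral {a..b} (pos_part n)"
  have Im: "0 \<le> ?Im" and In: "0 \<le> ?In"
    by (auto intro!: integral_nonneg pos_part_integrable m_L1 n_L1)
  obtain c1 t1 r1 where c1: "0 < c1" "0 < t1" "0 < r1"
    and g_le: "\<And>t. 0 \<le> t \<Longrightarrow> t \<le> t1 \<Longrightarrow> g t \<le> c1 * t powr r1"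
    and lim: "((\<lambda>t. t powr r1 / \<phi> t) \<longlongrightarrow> 0) (at_right 0)"
    using G1 unfolding cond_G1_def by auto
  \<comment> \<open>the summand 1 only keeps \<open>A\<close> positive when the weight \<open>n\<close> has no mass\<close>
  define A where "A = 4 * mu * c1 * (b - a) powr r1 * ?In + 1"
  have A: "1 \<le> A" using mu c1 In by (simp add: A_def)
  have "\<forall>\<^sub>F t in at_right 0. t powr r1 / \<phi> t < 1 / A"
    using order_tendstoD(2)[OF lim, of "1 / A"] A by simp
  then obtain r where r: "0 < r" "\<And>t. 0 < t \<Longrightarrow> t < r \<Longrightarrow> t powr r1 / \<phi> t < 1 / A"
    unfolding eventually_at_right_field by blast
  show thesis
  proof (rule that[of "min r (t1 / (b - a))"])
    show "0 < min r (t1 / (b - a))" using r c1 ab by simp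
    fix y assume y: "0 < y" "y < min r (t1 / (b - a))"
    let ?M = "(b - a) * y"
    have M: "0 < ?M" "?M \<le> t1" using y ab by (auto simp: field_simps)
    have phiy: "0 < \<phi> y" using y by simp
    have "y powr r1 < \<phi> y / A" using r(2)[of y] y phiy by (simp add: field_simps)
    then have Ay: "A * y powr r1 \<le> \<phi> y" using A by (simp add: field_simps)
    obtain Cf where Cf: "0 \<le> Cf" "\<And>t. 0 \<le> t \<Longrightarrow> t \<le> ?M \<Longrightarrow> f t \<le> Cf"
      using reaction_bound[OF f_cont] by blast
    define X where "X = Cf * ?Im + 1"
    have X: "0 < X" using Cf(1) Im by (simp add: X_def add_nonneg_pos)
    define lam0 where "lam0 = \<phi> y / (4 * X)"
    show "\<exists>lam0>0. \<forall>lam u. 0 \<le> lam \<longrightarrow> lam < lam0 \<longrightarrow> continuous_on {a..b} u \<longrightarrow>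
      (\<forall>x\<in>{a..b}. 0 \<le> u x \<and> u x \<le> (b - a) * y) \<longrightarrow> integral {a..b} (rhs lam mu u) \<le> \<phi> y / 2"
    proof (intro exI[of _ lam0] conjI allI impI)
      show "0 < lam0" using phiy X by (simp add: lam0_def)
      fix lam u assume lam: "0 \<le> lam" "lam < lam0" and uc: "continuous_on {a..b} u"
        and u: "\<forall>x\<in>{a..b}. 0 \<le> u x \<and> u x \<le> (b - a) * y"
      have "integral {a..b} (rhs lam mu u) \<le> lam * Cf * ?Im + mu * (c1 * ?M powr r1) * ?In"
      proof (rule integral_rhs_le[OF lam(1) mu uc])
        fix x assume x: "x \<in> {a..b}"
        show "0 \<le> u x" using u x by blast
        show "f (u x) \<le> Cf" using u x Cf(2) by blast
        have "g (u x) \<le> c1 * u x powr r1" using u x M by (intro g_le) force+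
        also have "\<dots> \<le> c1 * ?M powr r1" using u x c1 by (intro mult_left_mono powr_mono2) auto
        finally show "g (u x) \<le> c1 * ?M powr r1" .
      qed
      moreover have "lam * Cf * ?Im \<le> \<phi> y / 4"
      proof -
        have "lam * (Cf * ?Im) \<le> lam0 * X"
          using lam Cf(1) Im by (intro mult_mono) (auto simp: X_def)
        also have "\<dots> = \<phi> y / 4" using X by (simp add: lam0_def)
        finally show ?thesis by (simp add: mult.assoc)
      qed
      moreover have "mu * (c1 * ?M powr r1) * ?In \<le> \<phi> y / 4"
      proof -
        have "4 * (mu * (c1 * ?M powr r1) * ?In) = (A - 1) * y powr r1"
          using y ab by (simp add: A_def powr_mult)
        also have "\<dots> \<le> A * y powr r1" by (simp add: algebra_simps)
        also note Ay
        finally show ?thesis by simp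
      qed
      ultimately show "integral {a..b} (rhs lam mu u) \<le> \<phi> y / 2" by linarith
    qed
  qed
qed

section \<open>Small solutions\<close>

text \<open>
  The constant \<open>(b - a) * y\<close> is the upper barrier. The initial flux of a solution of the clipped problem
  with \<open>u b = 0\<close> is at most the mass of the source, hence at most \<open>\<phi> y\<close>. So all slopes are at most \<open>y\<close>
  and the barrier is never passed.
\<close>

lemma small_solutions:
  assumes mu: "0 < mu" and m0: "\<not> (AE x in lebesgue_on {a<..<b}. m x = 0)"
    and F: "cond_F \<phi> f" and G1: "cond_G1 \<phi> g"
  obtains y0 where "0 < y0" "\<And>y. 0 < y \<Longrightarrow> y < y0 \<Longrightarrow>
    \<exists>lam0>0. \<forall>lam. 0 < lam \<and> lam < lam0 \<longrightarrow>
      (\<exists>u. solution a b \<phi> f g m n lam mu u \<and> sup_norm_on a b u \<le> (b - a) * y)"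
proof -
  obtain t0 where t0: "0 < t0" and Ft0: "cond_F_at \<phi> f t0" using F by (auto simp: cond_F_def)
  obtain y1 where y1: "0 < y1"
    "\<And>y. 0 < y \<Longrightarrow> y < y1 \<Longrightarrow> \<exists>lam0>0. \<forall>lam u. 0 \<le> lam \<longrightarrow> lam < lam0 \<longrightarrow> continuous_on {a..b} u \<longrightarrow>
      (\<forall>x\<in>{a..b}. 0 \<le> u x \<and> u x \<le> (b - a) * y) \<longrightarrow> integral {a..b} (rhs lam mu u) \<le> \<phi> y / 2"
    using integral_rhs_small[OF G1 less_imp_le[OF mu]] by blast
  show thesis
  proof (rule that[of "min y1 (t0 / (b - a))"])
    show "0 < min y1 (t0 / (b - a))" using y1 t0 ab by simp
    fix y assume y: "0 < y" "y < min y1 (t0 / (b - a))"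
    let ?M = "(b - a) * y"
    have M: "0 < ?M" "?M \<le> t0" using y ab by (auto simp: field_simps)
    obtain lam0 where lam0: "0 < lam0"
      and small: "\<And>lam u. \<lbrakk>0 \<le> lam; lam < lam0; continuous_on {a..b} u; \<forall>x\<in>{a..b}. 0 \<le> u x \<and> u x \<le> ?M\<rbrakk>
        \<Longrightarrow> integral {a..b} (rhs lam mu u) \<le> \<phi> y / 2"
      using y1(2)[of y] y by auto
    have "\<exists>u. solution a b \<phi> f g m n lam mu u \<and> sup_norm_on a b u \<le> ?M" if lam: "0 < lam" "lam < lam0" for lam
    proof -
      have bd: "y * bdist x \<le> ?M" "0 \<le> bdist x" if "x \<in> {a..b}" for x
        using that y by (auto simp: bdist_def mult.commute)
      obtain e s u where e: "0 < e" "e \<le> y" and u: "ivp (clipped_rhs lam mu (\<lambda>x. e * bdist x) (\<lambda>_. ?M)) s u" "u b = 0"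
        and lower: "\<And>x. x \<in> {a..b} \<Longrightarrow> e * bdist x \<le> u x"
        using clipped_solution_above_barrier[OF lam(1) less_imp_le[OF mu] m0 continuous_on_const y(1) bd(1) M(2) Ft0]
        by blast
      let ?lo = "\<lambda>x. e * bdist x"
      have lo: "\<forall>x\<in>{a..b}. 0 \<le> ?lo x \<and> ?lo x \<le> ?M"
      proof
        fix x assume x: "x \<in> {a..b}"
        have "?lo x \<le> y * bdist x" by (rule mult_right_mono[OF e(2) bd(2)[OF x]])
        moreover have "0 \<le> ?lo x" using e bd(2)[OF x] by simp
        ultimately show "0 \<le> ?lo x \<and> ?lo x \<le> ?M" using bd(1)[OF x] by linarith
      qed
      have loc: "continuous_on {a..b} ?lo" unfolding bdist_def by (intro continuous_intros)
      let ?h = "rhs lam mu (\<lambda>t. clip (?lo t) ?M (u t))"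
      note iv = ivp_clipped[OF less_imp_le[OF lam(1)] less_imp_le[OF mu] loc continuous_on_const lo u(1)]
      have J: "integral {a..b} ?h \<le> \<phi> y / 2"
      proof (rule small[OF less_imp_le[OF lam(1)] lam(2) iv(4)], intro ballI)
        fix x assume "x \<in> {a..b}"
        then show "0 \<le> clip (?lo x) ?M (u x) \<and> clip (?lo x) ?M (u x) \<le> ?M" using lo by (auto simp: le_max_iff_disj)
      qed
      have "(b - a) * psi (s - integral {a..b} ?h) \<le> 0"
        using profile_end_ge[OF iv(1,2), where s = s] iv(3)[of b] u(2) ab by simp
      then have "s \<le> integral {a..b} ?h" using ab psi_pos_iff[of "s - integral {a..b} ?h"]
        by (simp add: mult_le_0_iff del: psi_pos_iff)
      then have s: "s \<le> \<phi> y" using J phi_pos_iff[of y] y(1) by linarith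
      have upper: "u x \<le> ?M" if "x \<in> {a..b}" for x
        using profile_le_initial_slope[OF iv(1,2) s _ that] iv(3)[OF that] y(1) by (simp add: less_imp_le)
      have z: "(a + b) / 2 \<in> {a..b}" "0 < bdist ((a + b) / 2)" using ab by (auto simp: bdist_def field_simps)
      then have "0 < e * bdist ((a + b) / 2)" using e by simp
      then have zpos: "0 < u ((a + b) / 2)" using lower[OF z(1)] by linarith
      have "solution a b \<phi> f g m n lam mu u"
        by (rule solution_of_clipped[OF less_imp_le[OF lam(1)] less_imp_le[OF mu] u _ lower upper z(1) zpos])
          (use lo in auto)
      then show ?thesis using solution_bounds(3) upper by blast
    qed
    then show "\<exists>lam0>0. \<forall>lam. 0 < lam \<and> lam < lam0 \<longrightarrow>
      (\<exists>u. solution a b \<phi> f g m n lam mu u \<and> sup_norm_on a b u \<le> ?M)" using lam0 by blast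
  qed
qed

text \<open>
  The solutions produced for different heights need not be related. Choosing for each \<open>lam\<close> a solution
  whose norm is least up to \<open>lam\<close> gives one family that inherits every bound.
\<close>

proposition small_solution_branch:
  assumes mu: "0 < mu" and m0: "\<not> (AE x in lebesgue_on {a<..<b}. m x = 0)"
    and F: "cond_F \<phi> f" and G1: "cond_G1 \<phi> g"
  shows "\<exists>lam0>0. \<exists>u :: real \<Rightarrow> real \<Rightarrow> real.
    (\<forall>lam. 0 < lam \<and> lam < lam0 \<longrightarrow> solution a b \<phi> f g m n lam mu (u lam)) \<and>
    ((\<lambda>lam. sup_norm_on a b (u lam)) \<longlongrightarrow> 0) (at_right 0)"
proof -
  obtain y0 where y0: "0 < y0" and small: "\<And>y. 0 < y \<Longrightarrow> y < y0 \<Longrightarrow>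
    \<exists>lam0>0. \<forall>lam. 0 < lam \<and> lam < lam0 \<longrightarrow>
      (\<exists>u. solution a b \<phi> f g m n lam mu u \<and> sup_norm_on a b u \<le> (b - a) * y)"
    using small_solutions[OF assms] by blast
  obtain lam0 where lam0: "0 < lam0" "\<And>lam. 0 < lam \<Longrightarrow> lam < lam0 \<Longrightarrow> \<exists>u. solution a b \<phi> f g m n lam mu u"
    using small[OF half_gt_zero[OF y0]] y0 by (metis field_sum_of_halves less_add_same_cancel1 half_gt_zero)
  have "\<exists>u. solution a b \<phi> f g m n lam mu u \<and>
      (\<forall>v. solution a b \<phi> f g m n lam mu v \<longrightarrow> sup_norm_on a b u \<le> sup_norm_on a b v + lam)"
    if lam: "0 < lam" "lam < lam0" for lam
  proof -
    let ?S = "sup_norm_on a b ` {u. solution a b \<phi> f g m n lam mu u}"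
    have ne: "?S \<noteq> {}" using lam0(2)[OF lam] by blast
    have bdd: "bdd_below ?S" using solution_bounds(2) by (intro bdd_belowI[of _ 0]) blast
    obtain r where r: "r \<in> ?S" "r < Inf ?S + lam" using cInf_lessD[OF ne, of "Inf ?S + lam"] lam by auto
    then obtain u where u: "solution a b \<phi> f g m n lam mu u" "sup_norm_on a b u < Inf ?S + lam" by blast
    moreover have "Inf ?S \<le> sup_norm_on a b v" if "solution a b \<phi> f g m n lam mu v" for v
      using that by (intro cInf_lower bdd) blast
    ultimately show ?thesis by (intro exI[of _ u]) fastforce
  qed
  then obtain U where U: "\<And>lam. 0 < lam \<Longrightarrow> lam < lam0 \<Longrightarrow> solution a b \<phi> f g m n lam mu (U lam)"
    "\<And>lam v. 0 < lam \<Longrightarrow> lam < lam0 \<Longrightarrow> solution a b \<phi> f g m n lam mu v \<Longrightarrow>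
      sup_norm_on a b (U lam) \<le> sup_norm_on a b v + lam" by metis
  have "((\<lambda>lam. sup_norm_on a b (U lam)) \<longlongrightarrow> 0) (at_right 0)"
  proof (rule tendstoI)
    fix r :: real assume r: "0 < r"
    define y where "y = min (y0 / 2) (r / (4 * (b - a)))"
    have y: "0 < y" "y < y0" using y0 r ab by (auto simp: y_def)
    have "y \<le> r / (4 * (b - a))" by (simp add: y_def)
    then have yr: "(b - a) * y \<le> r / 4" using ab by (simp add: field_simps)
    obtain l where l: "0 < l" "\<And>lam. 0 < lam \<Longrightarrow> lam < l \<Longrightarrow>
      \<exists>u. solution a b \<phi> f g m n lam mu u \<and> sup_norm_on a b u \<le> (b - a) * y"
      using small[OF y] by blast
    show "\<forall>\<^sub>F lam in at_right 0. dist (sup_norm_on a b (U lam)) 0 < r"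
      unfolding eventually_at_right_field
    proof (intro exI[of _ "min (min l lam0) (r / 4)"] conjI allI impI)
      show "0 < min (min l lam0) (r / 4)" using l lam0 r by simp
      fix lam :: real assume lam: "0 < lam" "lam < min (min l lam0) (r / 4)"
      then obtain v where v: "solution a b \<phi> f g m n lam mu v" "sup_norm_on a b v \<le> (b - a) * y"
        using l(2)[of lam] by auto
      have "sup_norm_on a b (U lam) \<le> sup_norm_on a b v + lam" using U(2)[OF _ _ v(1)] lam by simp
      moreover have "0 \<le> sup_norm_on a b (U lam)" using solution_bounds(2)[OF U(1)] lam by simp
      ultimately show "dist (sup_norm_on a b (U lam)) 0 < r" using v(2) yr lam r by (simp add: dist_real_def)
    qed
  qed
  then show ?thesis using lam0(1) U(1) by blast
qed

section \<open>Large solutions\<close>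

text \<open>
  Shooting between a small initial flux \<open>s1\<close>, for which the end value is positive, and a large one
  \<open>s2\<close>, for which it is negative. The argument of \<open>f\<close> and \<open>g\<close> is clipped to \<open>{0..M}\<close> with
  \<open>M = (b - a) * psi s2\<close>, a height that no solution with initial flux up to \<open>s2\<close> exceeds.
\<close>

proposition large_solutions:
  assumes mu: "0 < mu" and n0: "\<not> (AE x in lebesgue_on {a<..<b}. n x = 0)"
    and G1: "cond_G1 \<phi> g" and G2: "cond_G2 \<phi> g"
  shows "\<exists>lam1>0. \<exists>v :: real \<Rightarrow> real \<Rightarrow> real.
    (\<forall>lam. 0 < lam \<and> lam < lam1 \<longrightarrow> solution a b \<phi> f g m n lam mu (v lam)) \<and>
    (\<exists>\<rho>>0. \<forall>lam. 0 < lam \<and> lam < lam1 \<longrightarrow> \<rho> < sup_norm_on a b (v lam))"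
proof -
  let ?Im = "integral {a..b} (pos_part m)" and ?In = "integral {a..b} (pos_part n)"
  have Im: "0 \<le> ?Im" and In: "0 \<le> ?In"
    by (auto intro!: integral_nonneg pos_part_integrable m_L1 n_L1)
  obtain y1 where y1: "0 < y1"
    "\<And>y. 0 < y \<Longrightarrow> y < y1 \<Longrightarrow> \<exists>lam0>0. \<forall>lam u. 0 \<le> lam \<longrightarrow> lam < lam0 \<longrightarrow> continuous_on {a..b} u \<longrightarrow>
      (\<forall>x\<in>{a..b}. 0 \<le> u x \<and> u x \<le> (b - a) * y) \<longrightarrow> integral {a..b} (rhs lam mu u) \<le> \<phi> y / 2"
    using integral_rhs_small[OF G1 less_imp_le[OF mu]] by blast
  define y where "y = y1 / 2"
  have y: "0 < y" "y < y1" using y1 by (auto simp: y_def)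
  define s1 where "s1 = \<phi> y"
  have s1: "0 < s1" "psi s1 = y" using y by (auto simp: s1_def)
  define \<rho> where "\<rho> = (b - a) * y"
  have \<rho>: "0 < \<rho>" using y ab by (simp add: \<rho>_def)
  obtain lam1 where lam1: "0 < lam1"
    and small: "\<And>lam u. \<lbrakk>0 \<le> lam; lam < lam1; continuous_on {a..b} u; \<forall>x\<in>{a..b}. 0 \<le> u x \<and> u x \<le> \<rho>\<rbrakk>
        \<Longrightarrow> integral {a..b} (rhs lam mu u) \<le> s1 / 2"
    using y1(2)[OF y] unfolding \<rho>_def s1_def by auto
  obtain c2 t2 r2 where c2: "0 < c2" "0 < t2" "0 < r2"
    and g_ge: "\<And>t. t2 \<le> t \<Longrightarrow> c2 * t powr r2 \<le> g t"
    and lim: "filterlim (\<lambda>t. t powr r2 / \<phi> t) at_top at_top"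
    using G2 unfolding cond_G2_def by auto
  obtain d where d: "0 < d" "2 * d < b - a" and Jn: "0 < integral {a + d..b - d} (pos_part n)" (is "0 < ?Jn")
    using pos_part_integral_inner_pos[OF n_L1 n_nonneg n0] by blast
  define \<kappa> where "\<kappa> = d / (b - a)"
  have \<kappa>: "0 < \<kappa>" using d ab by (simp add: \<kappa>_def)
  \<comment> \<open>\<open>\<kappa> * R\<close> bounds a concave function of height \<open>R\<close> from below on the inner interval; \<open>A\<close> turns
    \<open>A * \<phi> t \<le> t powr r2\<close> at \<open>t = R / d\<close> into the fact \<open>super\<close> below\<close>
  define A where "A = 2 / (mu * c2 * (\<kappa> * d) powr r2 * ?Jn) + 1"
  have "\<forall>\<^sub>F t in at_top. A \<le> t powr r2 / \<phi> t" using lim by (simp add: filterlim_at_top)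
  then obtain T where T: "\<And>t. T \<le> t \<Longrightarrow> A \<le> t powr r2 / \<phi> t" by (auto simp: eventually_at_top_linorder)
  define R0 where "R0 = max (max (T * d) (t2 / \<kappa>)) 1"
  have R0: "0 < R0" by (simp add: R0_def)
  \<comment> \<open>the source mass forced by height \<open>R\<close> exceeds the flux drop \<open>2 * \<phi> (R / d)\<close> that a concave
    function of height \<open>R\<close> with nonnegative end values can have between \<open>a + d\<close> and \<open>b - d\<close>\<close>
  have super: "2 * \<phi> (R / d) < mu * (c2 * (\<kappa> * R) powr r2) * ?Jn" and big: "t2 \<le> \<kappa> * R" if R: "R0 \<le> R" for R
  proof -
    have "R > 0" "T \<le> R / d" "t2 / \<kappa> \<le> R" using R d R0 by (auto simp: R0_def field_simps)
    then show "t2 \<le> \<kappa> * R" using \<kappa> by (simp add: field_simps)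
    define t where "t = R / d"
    have t: "0 < t" "T \<le> t" using \<open>R > 0\<close> \<open>T \<le> R / d\<close> d by (auto simp: t_def)
    define D where "D = mu * c2 * (\<kappa> * d) powr r2 * ?Jn"
    have D: "0 < D" using mu c2 \<kappa> d Jn by (simp add: D_def)
    have phit: "0 < \<phi> t" using t by simp
    have "A * \<phi> t \<le> t powr r2" using T[OF t(2)] phit by (simp add: pos_le_divide_eq)
    moreover have "2 / D * \<phi> t < A * \<phi> t" unfolding A_def D_def[symmetric] using phit by (intro mult_strict_right_mono) auto
    ultimately have "2 / D * \<phi> t < t powr r2" by linarith
    then have "2 * \<phi> t < D * t powr r2" using D by (simp add: field_simps)
    also have "D * t powr r2 = mu * (c2 * (\<kappa> * R) powr r2) * ?Jn"
    proof -
      have "\<kappa> * R = \<kappa> * d * t" using d by (simp add: t_def)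
      then show ?thesis using \<kappa> d t by (simp add: D_def powr_mult)
    qed
    finally show "2 * \<phi> (R / d) < mu * (c2 * (\<kappa> * R) powr r2) * ?Jn" by (simp add: t_def)
  qed
  have "\<exists>u. solution a b \<phi> f g m n lam mu u \<and> \<rho> < sup_norm_on a b u" if lam: "0 < lam" "lam < lam1" for lam
  proof -
    have nn: "0 \<le> lam" "0 \<le> mu" using lam mu by auto
    obtain Cf where Cf: "0 \<le> Cf" "\<And>t. 0 \<le> t \<Longrightarrow> t \<le> R0 \<Longrightarrow> f t \<le> Cf" using reaction_bound[OF f_cont] by blast
    obtain Cg where Cg: "0 \<le> Cg" "\<And>t. 0 \<le> t \<Longrightarrow> t \<le> R0 \<Longrightarrow> g t \<le> Cg" using reaction_bound[OF g_cont] by blast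
    define C where "C = lam * Cf * ?Im + mu * Cg * ?In"
    have C: "0 \<le> C" using nn Cf Cg Im In by (simp add: C_def)
    \<comment> \<open>\<open>C\<close> bounds the source mass of functions below \<open>R0\<close>, so an initial flux of \<open>s2\<close> forces such a
      function to exceed \<open>R0\<close> at \<open>b\<close>\<close>
    define s2 where "s2 = s1 + C + \<phi> (R0 / (b - a))"
    have pR: "0 < \<phi> (R0 / (b - a))" using R0 ab by simp
    have s12: "s1 < s2" unfolding s2_def using C pR by linarith
    define M where "M = (b - a) * psi s2"
    have M: "0 < M" using s12 s1 ab by (simp add: M_def)
    let ?F = "clipped_rhs lam mu (\<lambda>_. 0) (\<lambda>_. M)"
    obtain K where K: "caratheodory ?F K"
      using clipped_rhs_caratheodory[OF nn continuous_on_const continuous_on_const] M by (metis less_imp_le order_refl)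
    have lohi: "\<forall>x\<in>{a..b}. 0 \<le> (0::real) \<and> 0 \<le> M" using M by simp
    note iv = ivp_clipped[OF nn continuous_on_const continuous_on_const lohi]
    \<comment> \<open>used twice: for \<open>s1\<close> itself, and to see that the solution found leaves \<open>{0..\<rho>}\<close>\<close>
    have pos: "0 < u b" if u: "ivp ?F s u" and s: "s1 \<le> s" and le: "\<And>x. x \<in> {a..b} \<Longrightarrow> u x \<le> \<rho>" for s u
    proof -
      let ?h = "rhs lam mu (\<lambda>t. clip 0 M (u t))"
      have "integral {a..b} ?h \<le> s1 / 2"
        using le \<rho> M by (intro small nn lam iv(4)[OF u]) (auto simp: min_le_iff_disj)
      then have "0 < (b - a) * psi (s - integral {a..b} ?h)" using s s1 ab by (intro mult_pos_pos) auto
      also have "\<dots> \<le> u b" using profile_end_ge[OF iv(1,2)[OF u], where s = s] iv(3)[OF u, of b] ab by simp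
      finally show ?thesis .
    qed
    have upper: "u x \<le> M" if u: "ivp ?F s u" and s: "s \<le> s2" and x: "x \<in> {a..b}" for s u x
      using profile_le_initial_slope[OF iv(1,2)[OF u] s _ x] iv(3)[OF u x] s1 s12 by (simp add: M_def)
    have lower: "0 \<le> u x" if u: "ivp ?F s u" and ub: "0 \<le> u b" and x: "x \<in> {a..b}" for s u x
      using profile_nonneg[OF iv(1,2)[OF u] _ x, where s = s] iv(3)[OF u x] iv(3)[OF u, of b] ub ab by simp
    have at_s1: "0 < u b" if u: "ivp ?F s1 u" for u
    proof (rule pos[OF u order_refl])
      show "u x \<le> \<rho>" if x: "x \<in> {a..b}" for x
        using profile_le_initial_slope[OF iv(1,2)[OF u] order_refl[of s1] _ x] iv(3)[OF u x] s1 by (simp add: \<rho>_def)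
    qed
    have at_s2: "u b < 0" if u: "ivp ?F s2 u" for u
    proof (rule ccontr)
      assume "\<not> u b < 0"
      then have ub: "0 \<le> u b" by simp
      let ?h = "rhs lam mu (\<lambda>t. clip 0 M (u t))"
      have range: "0 \<le> u x" "u x \<le> M" if "x \<in> {a..b}" for x
        using lower[OF u ub that] upper[OF u order_refl that] by auto
      have clip_id: "clip 0 M (u x) = u x" if "x \<in> {a..b}" for x using range[OF that] by simp
      have prof: "u x = profile s2 ?h x" if "x \<in> {a..b}" for x by (rule iv(3)[OF u that])
      obtain z where z: "z \<in> {a..b}" "\<And>x. x \<in> {a..b} \<Longrightarrow> u x \<le> u z"
        using continuous_attains_sup[OF compact_Icc _ iv(5)[OF u]] ab by fastforce
      define R where "R = u z"
      have "R0 \<le> R"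
      proof (rule ccontr)
        assume "\<not> R0 \<le> R"
        then have lt: "u x \<le> R0" if "x \<in> {a..b}" for x using z(2)[OF that] by (simp add: R_def)
        have "integral {a..b} ?h \<le> C"
          unfolding C_def
        proof (rule integral_rhs_le[OF nn iv(4)[OF u]])
          fix x assume x: "x \<in> {a..b}"
          show "0 \<le> clip 0 M (u x)" by simp
          show "f (clip 0 M (u x)) \<le> Cf" "g (clip 0 M (u x)) \<le> Cg"
            unfolding clip_id[OF x] using Cf(2) Cg(2) range[OF x] lt[OF x] by auto
        qed
        then have "\<phi> (R0 / (b - a)) < s2 - integral {a..b} ?h" using s1 by (simp add: s2_def)
        then have "R0 / (b - a) < psi (s2 - integral {a..b} ?h)" by (metis psi_less_iff psi_phi)
        then have "R0 < (b - a) * psi (s2 - integral {a..b} ?h)" using ab by (simp add: pos_divide_less_eq mult.commute)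
        also have "\<dots> \<le> u b" using profile_end_ge[OF iv(1,2)[OF u], where s = s2] prof[of b] ab by simp
        also have "u b \<le> R0" using lt[of b] ab by simp
        finally show False by simp
      qed
      have Rpos: "0 < R" using \<open>R0 \<le> R\<close> R0 by simp
      have ge: "R * bdist x \<le> (b - a) * u x" if "x \<in> {a..b}" for x
        using profile_ge_bdist[OF iv(1,2)[OF u] _ that z(1), where s = s2] prof[OF that] prof[OF z(1)] prof[of b] ub ab
        by (simp add: R_def)
      have "mu * (c2 * (\<kappa> * R) powr r2) * ?Jn \<le> integral {a + d..b - d} ?h"
      proof -
        have "integral {a + d..b - d} (\<lambda>x. mu * (c2 * (\<kappa> * R) powr r2) * pos_part n x) \<le> integral {a + d..b - d} ?h"
        proof (rule integral_le)
          show "(\<lambda>x. mu * (c2 * (\<kappa> * R) powr r2) * pos_part n x) integrable_on {a + d..b - d}"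
            using d by (intro integrable_on_mult_right integrable_on_subinterval[OF pos_part_integrable[OF n_L1]]) auto
          show "?h integrable_on {a + d..b - d}"
            using d by (intro integrable_on_subinterval[OF iv(1)[OF u]]) auto
          fix x assume x: "x \<in> {a + d..b - d}"
          then have xab: "x \<in> {a..b}" using d by auto
          have "R * d \<le> R * bdist x" using x Rpos by (intro mult_left_mono) (auto simp: bdist_def)
          also note ge[OF xab]
          finally have ux: "\<kappa> * R \<le> u x" using ab by (simp add: \<kappa>_def field_simps)
          have "c2 * (\<kappa> * R) powr r2 \<le> c2 * u x powr r2"
            using c2 \<kappa> Rpos ux by (intro mult_left_mono powr_mono2) auto
          also have "\<dots> \<le> g (u x)" using big[OF \<open>R0 \<le> R\<close>] ux by (intro g_ge) simp
          finally have "mu * pos_part n x * (c2 * (\<kappa> * R) powr r2) \<le> mu * pos_part n x * g (u x)"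
            using mu by (intro mult_left_mono) auto
          moreover have "0 \<le> lam * pos_part m x * f (u x)" using nn range[OF xab] by (simp add: f_nonneg)
          ultimately show "mu * (c2 * (\<kappa> * R) powr r2) * pos_part n x \<le> ?h x"
            unfolding rhs_def clip_id[OF xab] by (simp add: mult_ac)
        qed
        then show ?thesis by simp
      qed
      moreover have "integral {a + d..b - d} ?h \<le> 2 * \<phi> (R / d)"
      proof -
        have ad: "a + d \<in> {a..b}" "b - d \<in> {a..b}" "a \<in> {a..b}" "b \<in> {a..b}" using d by auto
        have "profile s2 ?h a \<le> profile s2 ?h (a + d) + (a - (a + d)) * psi (flux s2 ?h (a + d))"
          by (rule profile_le_tangent[OF iv(1,2)[OF u] ad(1,3)])
        also have "profile s2 ?h (a + d) \<le> R" using prof[OF ad(1)] z(2)[OF ad(1)] by (simp add: R_def)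
        finally have "psi (flux s2 ?h (a + d)) \<le> R / d" using d by (simp add: field_simps)
        then have 1: "flux s2 ?h (a + d) \<le> \<phi> (R / d)" by (metis phi_le_iff phi_psi)
        have "profile s2 ?h b \<le> profile s2 ?h (b - d) + (b - (b - d)) * psi (flux s2 ?h (b - d))"
          by (rule profile_le_tangent[OF iv(1,2)[OF u] ad(2,4)])
        also have "profile s2 ?h (b - d) \<le> R" using prof[OF ad(2)] z(2)[OF ad(2)] by (simp add: R_def)
        finally have "- (R / d) \<le> psi (flux s2 ?h (b - d))" using d ub prof[OF ad(4)] by (simp add: field_simps)
        then have 2: "- \<phi> (R / d) \<le> flux s2 ?h (b - d)" by (metis phi_le_iff phi_psi phi_odd)
        show ?thesis using 1 2 flux_diff[OF iv(1)[OF u], of "a + d" "b - d" s2] d by simp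
      qed
      ultimately show False using super[OF \<open>R0 \<le> R\<close>] by simp
    qed
    have "\<exists>s u. s1 \<le> s \<and> s \<le> s2 \<and> ivp ?F s u \<and> u b = 0"
    proof (rule shooting[OF K, of s1 s2])
      fix s u assume "min s1 s2 \<le> s" "s \<le> max s1 s2" "ivp ?F s u" "u b = 0"
      then show "\<exists>s u. s1 \<le> s \<and> s \<le> s2 \<and> ivp ?F s u \<and> u b = 0"
        using s12 by (intro exI[of _ s] exI[of _ u]) auto
    qed (fact at_s1 at_s2)+
    then obtain s u where s: "s1 \<le> s" "s \<le> s2" and u: "ivp ?F s u" "u b = 0" by blast
    obtain z where z: "z \<in> {a..b}" "\<rho> < u z" using pos[OF u(1) s(1)] u(2) by force
    have "0 < u z" using z(2) \<rho> by simp
    have "solution a b \<phi> f g m n lam mu u"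
      by (rule solution_of_clipped[OF nn u _ _ _ z(1) \<open>0 < u z\<close>]) (use lower[OF u(1)] upper[OF u(1) s(2)] u(2) in auto)
    then show ?thesis using solution_bounds(1)[OF _ z(1)] z(2) by fastforce
  qed
  then obtain v where "\<And>lam. 0 < lam \<Longrightarrow> lam < lam1 \<Longrightarrow> solution a b \<phi> f g m n lam mu (v lam) \<and> \<rho> < sup_norm_on a b (v lam)"
    by metis
  then show ?thesis using lam1 \<rho> by blast
qed

section \<open>Solutions below a supersolution\<close>

text \<open>
  If \<open>m\<close> is not null, the given solution \<open>v\<close> is the upper barrier. Where \<open>u\<close> exceeds \<open>v\<close> the clipped
  source is the reaction along \<open>v\<close> with the smaller parameter, hence at most the source of \<open>v\<close>, and
  comparison gives \<open>u \<le> v\<close>. By concavity \<open>v\<close> dominates a multiple of the distance to the boundary,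
  so a lower barrier fits below it.
\<close>

proposition solution_below_supersolution:
  assumes lam: "0 < lam" "lam \<le> lam'" and mu: "0 < mu"
    and sol: "solution a b \<phi> f g m n lam' mu v" and F: "\<And>t0. 0 < t0 \<Longrightarrow> cond_F_at \<phi> f t0"
  shows "\<exists>u. solution a b \<phi> f g m n lam mu u"
proof (cases "AE x in lebesgue_on {a<..<b}. m x = 0")
  case True
  have ae: "AE x in lebesgue_on {a<..<b}. ((\<lambda>y. \<phi> (ideriv a b v y)) has_real_derivative
           - (lam' * m x * f (v x) + mu * n x * g (v x))) (at x)"
    using sol by (simp add: solution_def)
  have "AE x in lebesgue_on {a<..<b}. ((\<lambda>y. \<phi> (ideriv a b v y)) has_real_derivative
           - (lam * m x * f (v x) + mu * n x * g (v x))) (at x)"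
    using True ae by eventually_elim simp
  then have "solution a b \<phi> f g m n lam mu v" using sol by (simp add: solution_def)
  then show ?thesis by blast
next
  case False
  have nn: "0 \<le> lam" "0 \<le> lam'" "0 \<le> mu" using lam mu by auto
  obtain \<sigma> where v: "continuous_on {a..b} v" "\<And>x. x \<in> {a..b} \<Longrightarrow> 0 \<le> v x" "v b = 0"
    and prof_v: "\<And>x. x \<in> {a..b} \<Longrightarrow> v x = profile \<sigma> (rhs lam' mu v) x"
    by (rule profile_of_solution[OF sol]) blast
  let ?k = "rhs lam' mu v" and ?z = "(a + b) / 2"
  have k: "?k integrable_on {a..b}" by (intro rhs_integrable v)
  have k0: "0 \<le> ?k x" if "x \<in> {a..b}" for x by (intro rhs_nonneg nn v that)
  have z: "?z \<in> {a..b}" "?z \<in> {a<..<b}" "0 < bdist ?z" using ab by (auto simp: bdist_def field_simps)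
  have vz: "0 < v ?z" using sol z by (simp add: solution_def pos_cone_interior_def)
  define e0 where "e0 = v ?z / (b - a)"
  have e0: "0 < e0" using vz ab by (simp add: e0_def)
  have barrier: "e0 * bdist x \<le> v x" if x: "x \<in> {a..b}" for x
  proof -
    have "v ?z * bdist x \<le> (b - a) * v x"
      using profile_ge_bdist[OF k k0 _ x z(1), where s = \<sigma>] prof_v[OF x] prof_v[OF z(1)] prof_v[of b] v(3) ab by simp
    then show ?thesis using ab by (simp add: e0_def field_simps)
  qed
  obtain w where w: "w \<in> {a..b}" "\<And>x. x \<in> {a..b} \<Longrightarrow> v x \<le> v w"
    using continuous_attains_sup[OF compact_Icc _ v(1)] ab by fastforce
  have "0 < v w" using vz w(2)[OF z(1)] by simp
  obtain e s u where e: "0 < e" "e \<le> e0" and u: "ivp (clipped_rhs lam mu (\<lambda>x. e * bdist x) v) s u" "u b = 0"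
      and lower: "\<And>x. x \<in> {a..b} \<Longrightarrow> e * bdist x \<le> u x"
    using clipped_solution_above_barrier[OF lam(1) nn(3) False v(1) e0 barrier w(2) F[OF \<open>0 < v w\<close>]] by blast
  let ?lo = "\<lambda>x. e * bdist x"
  have lo: "\<forall>x\<in>{a..b}. 0 \<le> ?lo x \<and> ?lo x \<le> v x"
  proof
    fix x assume x: "x \<in> {a..b}"
    have b0: "0 \<le> bdist x" using x by (simp add: bdist_def)
    have "?lo x \<le> e0 * bdist x" by (rule mult_right_mono[OF e(2) b0])
    moreover have "0 \<le> ?lo x" using e b0 by simp
    ultimately show "0 \<le> ?lo x \<and> ?lo x \<le> v x" using barrier[OF x] by linarith
  qed
  have loc: "continuous_on {a..b} ?lo" unfolding bdist_def by (intro continuous_intros)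
  let ?h = "rhs lam mu (\<lambda>t. clip (?lo t) (v t) (u t))"
  note iv = ivp_clipped[OF nn(1,3) loc v(1) lo u(1)]
  have upper: "u x \<le> v x" if x: "x \<in> {a..b}" for x
  proof -
    have "profile s ?h x \<le> profile \<sigma> ?k x"
    proof (rule profile_comparison[OF iv(1) k _ _ x])
      show "profile s ?h b \<le> profile \<sigma> ?k b" using iv(3)[of b] prof_v[of b] u(2) v(3) ab by simp
      fix t assume t: "t \<in> {a..b}" "profile \<sigma> ?k t < profile s ?h t"
      then have "v t < u t" using iv(3)[OF t(1)] prof_v[OF t(1)] by simp
      then have "clip (?lo t) (v t) (u t) = v t" using lo t(1) by auto
      then have "?h t = rhs lam mu v t" by (simp add: rhs_def)
      also have "\<dots> \<le> ?k t"
        unfolding rhs_def using lam v(2)[OF t(1)] by (intro add_right_mono mult_right_mono f_nonneg) auto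
      finally show "?h t \<le> ?k t" .
    qed
    then show ?thesis using iv(3)[OF x] prof_v[OF x] by simp
  qed
  have "0 < e * bdist ?z" using e z(3) by simp
  then have zpos: "0 < u ?z" using lower[OF z(1)] by linarith
  have "solution a b \<phi> f g m n lam mu u"
    by (rule solution_of_clipped[OF nn(1,3) u _ lower upper z(1) zpos]) (use lo in auto)
  then show ?thesis by blast
qed

end

section \<open>Positive solutions of the Dirichlet problem\<close>

theorem theorem1p1:
  fixes a b :: real and \<phi> f g m n :: "real \<Rightarrow> real"
  assumes ab: "a < b"
    and phi_odd: "\<And>x. \<phi> (- x) = - \<phi> x"
    and phi_mono: "strict_mono \<phi>"
    and phi_homeo: "homeomorphism UNIV UNIV \<phi> (inv \<phi>)"
    and f_cont: "continuous_on {0..} f" and f_nonneg: "\<And>t. 0 \<le> t \<Longrightarrow> 0 \<le> f t"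
    and g_cont: "continuous_on {0..} g" and g_nonneg: "\<And>t. 0 \<le> t \<Longrightarrow> 0 \<le> g t"
    and m_L1: "integrable (lebesgue_on {a<..<b}) m"
    and m_nonneg: "AE x in lebesgue_on {a<..<b}. 0 \<le> m x"
    and n_L1: "integrable (lebesgue_on {a<..<b}) n"
    and n_nonneg: "AE x in lebesgue_on {a<..<b}. 0 \<le> n x"
  shows
    "(\<not> (AE x in lebesgue_on {a<..<b}. m x = 0) \<and> cond_F \<phi> f \<and> cond_G1 \<phi> g \<longrightarrow>
        (\<forall>mu>0. \<exists>lam0>0. \<exists>u :: real \<Rightarrow> real \<Rightarrow> real.
           (\<forall>lam. 0 < lam \<and> lam < lam0 \<longrightarrow> solution a b \<phi> f g m n lam mu (u lam)) \<and>
           ((\<lambda>lam. sup_norm_on a b (u lam)) \<longlongrightarrow> 0) (at_right 0)))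
     \<and>
     (\<not> (AE x in lebesgue_on {a<..<b}. n x = 0) \<and> cond_G1 \<phi> g \<and> cond_G2 \<phi> g \<longrightarrow>
        (\<forall>mu>0. \<exists>lam1>0. \<exists>v :: real \<Rightarrow> real \<Rightarrow> real.
           (\<forall>lam. 0 < lam \<and> lam < lam1 \<longrightarrow> solution a b \<phi> f g m n lam mu (v lam)) \<and>
           (\<exists>\<rho>>0. \<forall>lam. 0 < lam \<and> lam < lam1 \<longrightarrow> \<rho> < sup_norm_on a b (v lam))))
     \<and>
     (\<forall>mu>0. {lam. 0 < lam \<and> (\<exists>u. solution a b \<phi> f g m n lam mu u)} \<noteq> {} \<and>
        (\<forall>t0>0. cond_F_at \<phi> f t0) \<longrightarrow>
        (let \<Lambda> = (SUP lam\<in>{lam. 0 < lam \<and> (\<exists>u. solution a b \<phi> f g m n lam mu u)}. ereal lam)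
         in 0 < \<Lambda> \<and>
            (\<forall>lam. 0 < lam \<and> ereal lam < \<Lambda> \<longrightarrow> (\<exists>w. solution a b \<phi> f g m n lam mu w))))"
proof -
  interpret dirichlet_problem a b \<phi> f g m n
    by (unfold_locales) (rule assms; assumption)+
  show ?thesis
  proof (intro conjI)
    show "\<not> (AE x in lebesgue_on {a<..<b}. m x = 0) \<and> cond_F \<phi> f \<and> cond_G1 \<phi> g \<longrightarrow>
        (\<forall>mu>0. \<exists>lam0>0. \<exists>u :: real \<Rightarrow> real \<Rightarrow> real.
           (\<forall>lam. 0 < lam \<and> lam < lam0 \<longrightarrow> solution a b \<phi> f g m n lam mu (u lam)) \<and>
           ((\<lambda>lam. sup_norm_on a b (u lam)) \<longlongrightarrow> 0) (at_right 0))"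
      by (intro impI allI small_solution_branch) simp_all
    show "\<not> (AE x in lebesgue_on {a<..<b}. n x = 0) \<and> cond_G1 \<phi> g \<and> cond_G2 \<phi> g \<longrightarrow>
        (\<forall>mu>0. \<exists>lam1>0. \<exists>v :: real \<Rightarrow> real \<Rightarrow> real.
           (\<forall>lam. 0 < lam \<and> lam < lam1 \<longrightarrow> solution a b \<phi> f g m n lam mu (v lam)) \<and>
           (\<exists>\<rho>>0. \<forall>lam. 0 < lam \<and> lam < lam1 \<longrightarrow> \<rho> < sup_norm_on a b (v lam)))"
      by (intro impI allI large_solutions) simp_all
    show "\<forall>mu>0. {lam. 0 < lam \<and> (\<exists>u. solution a b \<phi> f g m n lam mu u)} \<noteq> {} \<and>
        (\<forall>t0>0. cond_F_at \<phi> f t0) \<longrightarrow>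
        (let \<Lambda> = (SUP lam\<in>{lam. 0 < lam \<and> (\<exists>u. solution a b \<phi> f g m n lam mu u)}. ereal lam)
         in 0 < \<Lambda> \<and>
            (\<forall>lam. 0 < lam \<and> ereal lam < \<Lambda> \<longrightarrow> (\<exists>w. solution a b \<phi> f g m n lam mu w)))"
      unfolding Let_def
    proof (intro allI impI)
      fix mu :: real assume mu: "0 < mu"
      let ?S = "{lam. 0 < lam \<and> (\<exists>u. solution a b \<phi> f g m n lam mu u)}"
      assume asm: "?S \<noteq> {} \<and> (\<forall>t0>0. cond_F_at \<phi> f t0)"
      then obtain lam0 where lam0: "lam0 \<in> ?S" by blast
      then have "0 < ereal lam0" by simp
      also have "\<dots> \<le> (SUP lam\<in>?S. ereal lam)" by (rule SUP_upper[OF lam0])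
      finally have "0 < (SUP lam\<in>?S. ereal lam)" .
      moreover have "\<exists>w. solution a b \<phi> f g m n lam mu w"
        if lam: "0 < lam \<and> ereal lam < (SUP lam\<in>?S. ereal lam)" for lam
      proof -
        obtain lam' where "lam' \<in> ?S" "ereal lam < ereal lam'" using lam by (auto simp: less_SUP_iff)
        then obtain v where "lam \<le> lam'" "solution a b \<phi> f g m n lam' mu v" by auto
        then show ?thesis using solution_below_supersolution[OF _ _ mu] lam asm by blast
      qed
      ultimately show "0 < (SUP lam\<in>?S. ereal lam) \<and>
          (\<forall>lam. 0 < lam \<and> ereal lam < (SUP lam\<in>?S. ereal lam) \<longrightarrow> (\<exists>w. solution a b \<phi> f g m n lam mu w))"
        by blast
    qed
  qed
qed

end
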